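(* Let $G$ be a finitely generated group of polynomial growth and let $\mu$ be an adapted and smooth probability measure on $G$. If $f\in\mathrm{LHF}(G,\mu)$ satisfies $|f(x)|=o(|x|)$ as $|x|\to\infty$ (with $|\cdot|$ the word length), then $f$ is constant.
   Context: Fix a finite symmetric generating set $S$ of $G$ and let $|x|$ be the corresponding word length. $\mu$ is adapted if the semigroup generated by $\mathrm{supp}(\mu)$ is $G$; smooth if $\sum_x\mu(x)e^{\zeta|x|}<\infty$ for some $\zeta>0$. $\mathrm{LHF}(G,\mu)$ is the space of functions $f:G\to\mathbb C$ that are $\mu$-harmonic, i.e. $f(k)=\sum_g\mu(g)f(kg)$ (absolutely convergent) for all $k\in G$, and Lipschitz, i.e. $\sup_{s\in S,x\in G}|f(xs)-f(x)|<\infty$. *)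

theory Defs
  imports
    "HOL-Probability.Probability"
    "HOL-Library.Going_To_Filter"
    "HOL-Library.Landau_Symbols"
    "HOL-Algebra.Generated_Groups"
begin

definition symmetric_generating_set :: "('a, 'b) monoid_scheme \<Rightarrow> 'a set \<Rightarrow> bool" where
  "symmetric_generating_set G S \<longleftrightarrow>
     S \<subseteq> carrier G \<and> (\<forall>s\<in>S. inv\<^bsub>G\<^esub> s \<in> S) \<and> generate G S = carrier G"

text \<open>For a symmetric generating set, every element of the group is the product of a finite
  word in \<^term>\<open>S\<close>, so that the minimum below is attained on the whole carrier.\<close>

definition word_length :: "('a, 'b) monoid_scheme \<Rightarrow> 'a set \<Rightarrow> 'a \<Rightarrow> nat" where
  "word_length G S x =
     (LEAST n. \<exists>w. set w \<subseteq> S \<and> length w = n \<and> foldr (\<lambda>s y. s \<otimes>\<^bsub>G\<^esub> y) w \<one>\<^bsub>G\<^esub> = x)"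

definition word_ball :: "('a, 'b) monoid_scheme \<Rightarrow> 'a set \<Rightarrow> nat \<Rightarrow> 'a set" where
  "word_ball G S n = {x \<in> carrier G. word_length G S x \<le> n}"

definition polynomial_growth :: "('a, 'b) monoid_scheme \<Rightarrow> 'a set \<Rightarrow> bool" where
  "polynomial_growth G S \<longleftrightarrow>
     (\<exists>(C::real) (d::nat). \<forall>n\<ge>1. real (card (word_ball G S n)) \<le> C * real n ^ d)"

inductive_set semigroup_generated :: "('a, 'b) monoid_scheme \<Rightarrow> 'a set \<Rightarrow> 'a set"
  for G (structure) and A :: "'a set" where
    incl: "a \<in> A \<Longrightarrow> a \<in> semigroup_generated G A"
  | mult: "x \<in> semigroup_generated G A \<Longrightarrow> y \<in> semigroup_generated G A \<Longrightarrow>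
             x \<otimes> y \<in> semigroup_generated G A"

text \<open>A finitely generated group is countable, so its probability measures are exactly the
  probability mass functions whose support lies in the carrier.\<close>

definition adapted :: "('a, 'b) monoid_scheme \<Rightarrow> 'a pmf \<Rightarrow> bool" where
  "adapted G \<mu> \<longleftrightarrow> semigroup_generated G (set_pmf \<mu>) = carrier G"

definition smooth :: "('a, 'b) monoid_scheme \<Rightarrow> 'a set \<Rightarrow> 'a pmf \<Rightarrow> bool" where
  "smooth G S \<mu> \<longleftrightarrow>
     (\<exists>\<zeta>>0. (\<lambda>x. pmf \<mu> x * exp (\<zeta> * real (word_length G S x))) summable_on carrier G)"

definition harmonic :: "('a, 'b) monoid_scheme \<Rightarrow> 'a pmf \<Rightarrow> ('a \<Rightarrow> complex) \<Rightarrow> bool" where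
  "harmonic G \<mu> f \<longleftrightarrow>
     (\<forall>k\<in>carrier G.
        (\<lambda>g. norm (of_real (pmf \<mu> g) * f (k \<otimes>\<^bsub>G\<^esub> g))) summable_on carrier G \<and>
        f k = (\<Sum>\<^sub>\<infinity>g\<in>carrier G. of_real (pmf \<mu> g) * f (k \<otimes>\<^bsub>G\<^esub> g)))"

definition lipschitz :: "('a, 'b) monoid_scheme \<Rightarrow> 'a set \<Rightarrow> ('a \<Rightarrow> complex) \<Rightarrow> bool" where
  "lipschitz G S f \<longleftrightarrow>
     bdd_above ((\<lambda>(s, x). cmod (f (x \<otimes>\<^bsub>G\<^esub> s) - f x)) ` (S \<times> carrier G))"

text \<open>Functions on the group are represented by total functions on the ambient type; their
  values outside the carrier are unconstrained and never used.\<close>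

definition LHF :: "('a, 'b) monoid_scheme \<Rightarrow> 'a set \<Rightarrow> 'a pmf \<Rightarrow> ('a \<Rightarrow> complex) set" where
  "LHF G S \<mu> = {f. harmonic G \<mu> f \<and> lipschitz G S f}"

end

theory Submission
  imports Defs "HOL-Real_Asymp.Real_Asymp"
begin

text \<open>Write \<open>\<nu>\<^sub>n\<close> for the law of the walk after \<open>n\<close> steps. Polynomial growth makes its entropy
  \<open>O(log n)\<close>, so for infinitely many \<open>n\<close> the entropy increment is \<open>O(1/n)\<close>; this increment dominates
  the \<open>\<mu>\<close>-mean over \<open>g\<close> of the squared Hellinger distance of \<open>g \<nu>\<^sub>n\<close> and \<open>\<nu>\<^sub>n\<^sub>+\<^sub>1\<close>. On real Lipschitz harmonic
  functions vanishing at \<open>1\<close>, let \<open>B h k\<close> be a limit of \<open>E(h k)/n\<close> under \<open>\<nu>\<^sub>n\<close> along such \<open>n\<close>. As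
  \<open>h(g) = E h(g X) - E h(X')\<close> with \<open>X\<close>, \<open>X'\<close> distributed as \<open>\<nu>\<^sub>n\<close>, \<open>\<nu>\<^sub>n\<^sub>+\<^sub>1\<close>, the Cauchy-Schwarz inequality
  yields \<open>h(g)\<^sup>2 \<le> 4 d(g) B h h\<close> with \<open>d\<close> of finite \<open>\<mu>\<close>-mean, and the same distance estimate makes \<open>B\<close>
  invariant under translation. So \<open>B\<close> is an invariant inner product; summing the bound over an
  orthonormal family and over the martingale increments bounds the size of that family, so the space
  is finite-dimensional. For sublinear \<open>h\<close>, averaging over balls with small boundary exhibits \<open>h(g)\<close>
  as the limiting ball mean of \<open>h\<close> minus its \<open>g\<close>-translate. A linear functional on a
  finite-dimensional space is bounded and translation is isometric, so \<open>h\<close> is bounded, whence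
  \<open>B h h = 0\<close> and \<open>h = 0\<close>.\<close>

section \<open>Entropy and Hellinger distance of mixtures\<close>

text \<open>The squared Hellinger distance is used because it copes with unbounded functions:
  factoring p - q as (sqrt p - sqrt q)(sqrt p + sqrt q), Cauchy-Schwarz asks only for second
  moments. Those of a Lipschitz harmonic function grow at most linearly in n, by orthogonality of
  martingale increments. A squared distance of order 1/n against moments of order n leaves a bound
  of order one, which is why the form is normalised by n. Two obstacles shape the limits. The form
  must exist for all pairs of functions, possibly uncountably many, before finite dimension is
  known; hence a filter obtained from Tychonoff's theorem instead of a subsequence. Invariance needs
  two limits in succession: n first, with the number m of absorbing steps fixed, and m afterwards.
  The ball means of a single function need not converge. The averaging functional therefore lives on
  the subspace where they do; differences of a sublinear function and its translates belong to it
  even when the function itself does not.\<close>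

lemma
  fixes f :: "'b \<Rightarrow> real"
  assumes f: "integrable (bind_pmf p k) f"
  shows bind_pmf_integrable: "integrable p (\<lambda>x. \<integral>y. f y \<partial>k x)"
    and bind_pmf_integral: "(\<integral>y. f y \<partial>bind_pmf p k) = (\<integral>x. \<integral>y. f y \<partial>k x \<partial>p)"
proof -
  have "(\<integral>\<^sup>+x. \<integral>\<^sup>+y. ennreal (norm (f y)) \<partial>k x \<partial>p) < \<infinity>"
    using f by (simp add: integrable_iff_bounded)
  then have "AE x in p. (\<integral>\<^sup>+y. ennreal (norm (f y)) \<partial>k x) \<noteq> \<infinity>"
    by (intro nn_integral_PInf_AE) auto
  then have ker: "integrable (k x) f" if "x \<in> set_pmf p" for x
    using that by (auto simp: AE_measure_pmf_iff integrable_iff_bounded less_top)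
  \<comment> \<open>For nonnegative functions the iterated integral is computed in
    \<open>ennreal\<close>; the signed case follows from positive and negative parts.\<close>
  have nonneg: "integrable p (\<lambda>x. \<integral>y. h y \<partial>k x) \<and> (\<integral>x. \<integral>y. h y \<partial>k x \<partial>p) = (\<integral>y. h y \<partial>bind_pmf p k)"
    if h: "integrable (bind_pmf p k) h" "\<And>y. 0 \<le> h y" "\<And>x. x \<in> set_pmf p \<Longrightarrow> integrable (k x) h"
    for h :: "'b \<Rightarrow> real"
  proof -
    have "(\<integral>\<^sup>+x. ennreal (\<integral>y. h y \<partial>k x) \<partial>p) = (\<integral>\<^sup>+x. \<integral>\<^sup>+y. ennreal (h y) \<partial>k x \<partial>p)"
      using h by (intro nn_integral_cong_AE) (auto simp: AE_measure_pmf_iff nn_integral_eq_integral)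
    also have "\<dots> = ennreal (\<integral>y. h y \<partial>bind_pmf p k)"
      using h by (simp add: nn_integral_eq_integral flip: nn_integral_bind_pmf)
    finally show ?thesis
      using h by (subst (asm) nn_integral_eq_integrable) auto
  qed
  have pos: "integrable (bind_pmf p k) (\<lambda>y. max (f y) 0)" "integrable (bind_pmf p k) (\<lambda>y. max (- f y) 0)"
    using f by (auto intro!: integrable_max)
  have kpos: "integrable (k x) (\<lambda>y. max (f y) 0)" "integrable (k x) (\<lambda>y. max (- f y) 0)"
    if "x \<in> set_pmf p" for x
    using ker[OF that] by (auto intro!: integrable_max)
  have split: "f = (\<lambda>y. max (f y) 0 - max (- f y) 0)" by (auto simp: max_def)
  have ksplit: "(\<integral>y. f y \<partial>k x) = (\<integral>y. max (f y) 0 \<partial>k x) - (\<integral>y. max (- f y) 0 \<partial>k x)"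
    if "x \<in> set_pmf p" for x
    by (subst split, subst Bochner_Integration.integral_diff) (use kpos that in auto)
  note P = nonneg[OF pos(1) _ kpos(1), simplified] and N = nonneg[OF pos(2) _ kpos(2), simplified]
  have diff: "integrable p (\<lambda>x. (\<integral>y. max (f y) 0 \<partial>k x) - (\<integral>y. max (- f y) 0 \<partial>k x))"
    using P N by auto
  show "integrable p (\<lambda>x. \<integral>y. f y \<partial>k x)"
    using diff by (rule integrable_cong_AE_imp) (auto simp: AE_measure_pmf_iff ksplit)
  have "(\<integral>y. f y \<partial>bind_pmf p k) = (\<integral>y. max (f y) 0 \<partial>bind_pmf p k) - (\<integral>y. max (- f y) 0 \<partial>bind_pmf p k)"
    by (subst split, subst Bochner_Integration.integral_diff) (use pos in auto)
  also have "\<dots> = (\<integral>x. (\<integral>y. max (f y) 0 \<partial>k x) - (\<integral>y. max (- f y) 0 \<partial>k x) \<partial>p)"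
    using P N by simp
  also have "\<dots> = (\<integral>x. \<integral>y. f y \<partial>k x \<partial>p)"
    by (intro integral_cong_AE) (auto simp: AE_measure_pmf_iff ksplit)
  finally show "(\<integral>y. f y \<partial>bind_pmf p k) = (\<integral>x. \<integral>y. f y \<partial>k x \<partial>p)" .
qed

text \<open>Counting measure on an arbitrary type need not be sigma-finite, so Tonelli is not
  directly available. Writing \<open>p\<close> as a density over counting measure turns both sides
  into double sums.\<close>

lemma nn_integral_pmf_count_space_swap:
  "(\<integral>\<^sup>+z. (\<integral>\<^sup>+x. F x z \<partial>measure_pmf p) \<partial>count_space UNIV)
     = (\<integral>\<^sup>+x. (\<integral>\<^sup>+z. F x z \<partial>count_space UNIV) \<partial>measure_pmf p)"
proof -
  have "(\<integral>\<^sup>+z. (\<integral>\<^sup>+x. F x z \<partial>measure_pmf p) \<partial>count_space UNIV)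
      = (\<integral>\<^sup>+z. (\<integral>\<^sup>+x. pmf p x * F x z \<partial>count_space UNIV) \<partial>count_space UNIV)"
    by (simp add: measure_pmf_eq_density nn_integral_density)
  also have "\<dots> = (\<integral>\<^sup>+x. (\<integral>\<^sup>+z. pmf p x * F x z \<partial>count_space UNIV) \<partial>count_space UNIV)"
    using nn_integral_snd_count_space[of "\<lambda>(x, z). pmf p x * F x z"]
      nn_integral_fst_count_space[of "\<lambda>(x, z). pmf p x * F x z"] by simp
  also have "\<dots> = (\<integral>\<^sup>+x. (\<integral>\<^sup>+z. F x z \<partial>count_space UNIV) \<partial>measure_pmf p)"
    by (simp add: measure_pmf_eq_density nn_integral_density nn_integral_cmult)
  finally show ?thesis .
qed

text \<open>Shannon entropy. Every term is nonnegative since masses are at most 1, so values in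
  \<open>ennreal\<close> lose nothing and allow infinite entropy.\<close>

definition pmf_entropy :: "'a pmf \<Rightarrow> ennreal" where
  "pmf_entropy p = (\<integral>\<^sup>+z. ennreal (- pmf p z * ln (pmf p z)) \<partial>count_space UNIV)"

text \<open>The squared Hellinger distance without the customary factor 1/2, so its maximum is
  2.\<close>

definition hellinger :: "'a pmf \<Rightarrow> 'a pmf \<Rightarrow> ennreal" where
  "hellinger p q = (\<integral>\<^sup>+z. ennreal ((sqrt (pmf p z) - sqrt (pmf q z))\<^sup>2) \<partial>count_space UNIV)"

text \<open>Pointwise form of "squared Hellinger distance is at most relative entropy": apply ln t
  <= t - 1 at t = sqrt (q / a). The correction \<open>- a + q\<close> integrates to zero between
  probability measures.\<close>

lemma sqrt_diff_square_le:
  fixes a q :: real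
  assumes "0 \<le> a" "0 < q"
  shows "(sqrt a - sqrt q)\<^sup>2 \<le> a * ln a - a + q - a * ln q"
proof (cases "a = 0")
  case False
  with assms have a: "a > 0" by simp
  define t where "t = sqrt (q / a)"
  have t: "t > 0" using a assms by (simp add: t_def)
  have "ln t \<le> t - 1" using t by (rule ln_le_minus_one)
  moreover have "ln t = (ln q - ln a) / 2"
    using a assms by (simp add: t_def ln_sqrt ln_div)
  ultimately have "ln q - ln a \<le> 2 * t - 2" by simp
  then have "a * (ln q - ln a) \<le> a * (2 * t - 2)" using a by simp
  moreover have "a * t = sqrt a * sqrt q"
  proof -
    have "a * t = (sqrt a * sqrt a) * (sqrt q / sqrt a)" using a by (simp add: t_def real_sqrt_divide)
    then show ?thesis using a by (simp del: real_sqrt_mult_self)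
  qed
  ultimately show ?thesis using a assms
    by (simp add: power2_diff algebra_simps)
qed (use assms in simp)

lemma mult_ln_nonpos:
  fixes a :: real assumes "0 \<le> a" "a \<le> 1" shows "a * ln a \<le> 0"
  using assms by (cases "a = 0") (auto simp: mult_nonneg_nonpos)

lemma mult_ln_ge:
  fixes a :: real assumes "0 \<le> a" shows "a - 1 \<le> a * ln a"
  using order.trans[OF zero_le_power2 sqrt_diff_square_le[of a 1]] assms by simp

text \<open>The entropy of a mixture minus the mean entropy of its components is the mean relative
  entropy of a component to the mixture, and this dominates the Hellinger distance. A sum on the
  left avoids subtraction in \<open>ennreal\<close>; the inequality already holds at each point
  \<open>z\<close>.\<close>

lemma hellinger_le_entropy_gap:
  "(\<integral>\<^sup>+x. hellinger (k x) (bind_pmf p k) \<partial>measure_pmf p) + (\<integral>\<^sup>+x. pmf_entropy (k x) \<partial>measure_pmf p)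
     \<le> pmf_entropy (bind_pmf p k)"
proof -
  have "(\<integral>\<^sup>+x. ennreal ((sqrt (pmf (k x) z) - sqrt (pmf (bind_pmf p k) z))\<^sup>2) \<partial>measure_pmf p)
      + (\<integral>\<^sup>+x. ennreal (- pmf (k x) z * ln (pmf (k x) z)) \<partial>measure_pmf p)
      \<le> ennreal (- pmf (bind_pmf p k) z * ln (pmf (bind_pmf p k) z))" for z
  proof -
    define a where "a x = pmf (k x) z" for x
    define q where "q = pmf (bind_pmf p k) z"
    have a: "0 \<le> a x" "a x \<le> 1" for x by (auto simp: a_def pmf_le_1)
    have q: "0 \<le> q" "q \<le> 1" by (auto simp: q_def pmf_le_1)
    have qa: "q = (\<integral>x. a x \<partial>p)" by (simp add: q_def a_def pmf_bind)
    have ia: "integrable p a"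
      by (rule measure_pmf.integrable_const_bound[where B=1]) (use a in auto)
    have il: "integrable p (\<lambda>x. - a x * ln (a x))"
    proof (rule measure_pmf.integrable_const_bound[where B=1])
      have "\<bar>- a x * ln (a x)\<bar> \<le> 1" for x
        using mult_ln_ge[of "a x"] mult_ln_nonpos[of "a x"] a[of x] by auto
      then show "AE x in p. norm (- a x * ln (a x)) \<le> 1" by auto
    qed auto
    have isq: "integrable p (\<lambda>x. (sqrt (a x) - sqrt q)\<^sup>2)"
    proof (rule measure_pmf.integrable_const_bound[where B=1])
      have "\<bar>sqrt (a x) - sqrt q\<bar> \<le> 1" for x
        using a[of x] q by (smt (verit, best) real_sqrt_ge_zero real_sqrt_le_1_iff)
      then show "AE x in p. norm ((sqrt (a x) - sqrt q)\<^sup>2) \<le> 1"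
        by (simp add: abs_square_le_1)
    qed auto
    have "(\<integral>x. (sqrt (a x) - sqrt q)\<^sup>2 \<partial>p) + (\<integral>x. - a x * ln (a x) \<partial>p) \<le> - q * ln q"
    proof (cases "q = 0")
      \<comment> \<open>\<open>sqrt_diff_square_le\<close> needs \<open>0 < q\<close>. If
        \<open>q = 0\<close>, almost every \<open>a x\<close> vanishes and both sides are 0.\<close>
      case True
      then have "AE x in p. a x = 0"
        using integral_nonneg_eq_0_iff_AE[OF ia] a qa by auto
      then have "(\<integral>x. (sqrt (a x) - sqrt q)\<^sup>2 \<partial>p) = (\<integral>x. 0 \<partial>p)" "(\<integral>x. - a x * ln (a x) \<partial>p) = (\<integral>x. 0 \<partial>p)"
        using True by (intro integral_cong_AE; simp add: AE_measure_pmf_iff)+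
      then show ?thesis using True by simp
    next
      case False
      then have "q > 0" using q by simp
      have "(\<integral>x. (sqrt (a x) - sqrt q)\<^sup>2 \<partial>p) \<le> (\<integral>x. - (- a x * ln (a x)) - a x + q - a x * ln q \<partial>p)"
        using isq il ia sqrt_diff_square_le[OF a(1) \<open>q > 0\<close>] by (intro integral_mono) auto
      also have "\<dots> = - (\<integral>x. - a x * ln (a x) \<partial>p) - q + q - q * ln q"
        using il ia qa by (simp del: mult_minus_left)
      finally show ?thesis by simp
    qed
    moreover have "0 \<le> (\<integral>x. (sqrt (a x) - sqrt q)\<^sup>2 \<partial>p)" by simp
    moreover have "0 \<le> (\<integral>x. - a x * ln (a x) \<partial>p)"
      using mult_ln_nonpos[of "a _"] a by (intro integral_nonneg_AE) auto
    moreover have "(\<integral>\<^sup>+x. ennreal ((sqrt (a x) - sqrt q)\<^sup>2) \<partial>p) = ennreal (\<integral>x. (sqrt (a x) - sqrt q)\<^sup>2 \<partial>p)"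
      using isq by (intro nn_integral_eq_integral) auto
    moreover have "(\<integral>\<^sup>+x. ennreal (- a x * ln (a x)) \<partial>p) = ennreal (\<integral>x. - a x * ln (a x) \<partial>p)"
      using il mult_ln_nonpos[of "a _"] a by (intro nn_integral_eq_integral) auto
    ultimately show ?thesis
      unfolding a_def[symmetric] q_def[symmetric] by (simp add: ennreal_leI flip: ennreal_plus)
  qed
  then have "(\<integral>\<^sup>+z. ((\<integral>\<^sup>+x. ennreal ((sqrt (pmf (k x) z) - sqrt (pmf (bind_pmf p k) z))\<^sup>2) \<partial>measure_pmf p)
      + (\<integral>\<^sup>+x. ennreal (- pmf (k x) z * ln (pmf (k x) z)) \<partial>measure_pmf p)) \<partial>count_space UNIV)
      \<le> pmf_entropy (bind_pmf p k)"
    unfolding pmf_entropy_def by (intro nn_integral_mono) auto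
  then show ?thesis
    by (simp add: nn_integral_add nn_integral_pmf_count_space_swap hellinger_def pmf_entropy_def)
qed

text \<open>Cauchy-Schwarz applied to the factors sqrt p - sqrt q and (sqrt p + sqrt q) |h|. The
  factor 2 comes from (sqrt p + sqrt q)^2 <= 2 (p + q).\<close>

lemma hellinger_square_expectation_diff:
  fixes h :: "'a \<Rightarrow> real"
  assumes "integrable (measure_pmf p) h" "integrable (measure_pmf q) h"
    and p2: "integrable (measure_pmf p) (\<lambda>z. (h z)\<^sup>2)" and q2: "integrable (measure_pmf q) (\<lambda>z. (h z)\<^sup>2)"
  shows "ennreal (((\<integral>z. h z \<partial>measure_pmf p) - (\<integral>z. h z \<partial>measure_pmf q))\<^sup>2)
     \<le> 2 * hellinger p q * ennreal ((\<integral>z. (h z)\<^sup>2 \<partial>measure_pmf p) + (\<integral>z. (h z)\<^sup>2 \<partial>measure_pmf q))"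
proof -
  let ?C = "count_space (UNIV :: 'a set)"
  have ip: "integrable ?C (\<lambda>z. pmf p z * h z)" and iq: "integrable ?C (\<lambda>z. pmf q z * h z)"
    using assms by (auto simp: measure_pmf_eq_density integrable_density)
  have ep: "(\<integral>z. h z \<partial>measure_pmf r) = (\<integral>z. pmf r z * h z \<partial>?C)" for r
    by (simp add: measure_pmf_eq_density integral_density)
  have "\<bar>(\<integral>z. h z \<partial>measure_pmf p) - (\<integral>z. h z \<partial>measure_pmf q)\<bar> = \<bar>\<integral>z. (pmf p z - pmf q z) * h z \<partial>?C\<bar>"
    using ip iq by (simp add: ep left_diff_distrib)
  then have "ennreal \<bar>(\<integral>z. h z \<partial>measure_pmf p) - (\<integral>z. h z \<partial>measure_pmf q)\<bar>
      \<le> (\<integral>\<^sup>+z. ennreal \<bar>(pmf p z - pmf q z) * h z\<bar> \<partial>?C)"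
    using integral_norm_bound_ennreal[of ?C "\<lambda>z. (pmf p z - pmf q z) * h z"] ip iq
    by (simp add: left_diff_distrib)
  also have "\<dots> = (\<integral>\<^sup>+z. ennreal \<bar>sqrt (pmf p z) - sqrt (pmf q z)\<bar>
                   * ennreal ((sqrt (pmf p z) + sqrt (pmf q z)) * \<bar>h z\<bar>) \<partial>?C)"
  proof (intro nn_integral_cong)
    fix z
    have "pmf p z - pmf q z = (sqrt (pmf p z) - sqrt (pmf q z)) * (sqrt (pmf p z) + sqrt (pmf q z))"
      by (simp add: algebra_simps)
    then show "ennreal \<bar>(pmf p z - pmf q z) * h z\<bar> = ennreal \<bar>sqrt (pmf p z) - sqrt (pmf q z)\<bar>
                   * ennreal ((sqrt (pmf p z) + sqrt (pmf q z)) * \<bar>h z\<bar>)"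
      by (simp add: abs_mult ennreal_mult[symmetric] mult.assoc)
  qed
  finally have "ennreal \<bar>(\<integral>z. h z \<partial>measure_pmf p) - (\<integral>z. h z \<partial>measure_pmf q)\<bar> ^ 2 \<le> \<dots> ^ 2"
    by (intro power_mono) auto
  also have "\<dots> \<le> (\<integral>\<^sup>+z. ennreal \<bar>sqrt (pmf p z) - sqrt (pmf q z)\<bar> ^ 2 \<partial>?C)
          * (\<integral>\<^sup>+z. ennreal ((sqrt (pmf p z) + sqrt (pmf q z)) * \<bar>h z\<bar>) ^ 2 \<partial>?C)"
    by (rule Cauchy_Schwarz_nn_integral) auto
  also have "(\<integral>\<^sup>+z. ennreal \<bar>sqrt (pmf p z) - sqrt (pmf q z)\<bar> ^ 2 \<partial>?C) = hellinger p q"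
    unfolding hellinger_def by (intro nn_integral_cong) (simp add: ennreal_power)
  finally have CS: "ennreal (((\<integral>z. h z \<partial>measure_pmf p) - (\<integral>z. h z \<partial>measure_pmf q))\<^sup>2) \<le> hellinger p q
      * (\<integral>\<^sup>+z. ennreal ((sqrt (pmf p z) + sqrt (pmf q z)) * \<bar>h z\<bar>) ^ 2 \<partial>?C)"
    by (simp add: ennreal_power)
  have "(\<integral>\<^sup>+z. ennreal ((sqrt (pmf p z) + sqrt (pmf q z)) * \<bar>h z\<bar>) ^ 2 \<partial>?C)
      \<le> (\<integral>\<^sup>+z. 2 * (ennreal (pmf p z) * ennreal ((h z)\<^sup>2) + ennreal (pmf q z) * ennreal ((h z)\<^sup>2)) \<partial>?C)"
  proof (intro nn_integral_mono)
    fix z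
    have "(sqrt (pmf p z) + sqrt (pmf q z))\<^sup>2 \<le> 2 * (pmf p z + pmf q z)"
      using sum_squares_bound[of "sqrt (pmf p z)" "sqrt (pmf q z)"] by (simp add: power2_sum)
    then have "(sqrt (pmf p z) + sqrt (pmf q z))\<^sup>2 * (h z)\<^sup>2 \<le> 2 * (pmf p z * (h z)\<^sup>2 + pmf q z * (h z)\<^sup>2)"
      using mult_right_mono[of "(sqrt (pmf p z) + sqrt (pmf q z))\<^sup>2" "2 * (pmf p z + pmf q z)" "(h z)\<^sup>2"]
      by (simp add: algebra_simps)
    then show "ennreal ((sqrt (pmf p z) + sqrt (pmf q z)) * \<bar>h z\<bar>) ^ 2
      \<le> 2 * (ennreal (pmf p z) * ennreal ((h z)\<^sup>2) + ennreal (pmf q z) * ennreal ((h z)\<^sup>2))"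
      by (simp add: ennreal_power power_mult_distrib flip: ennreal_mult ennreal_plus ennreal_numeral)
  qed
  also have "\<dots> = 2 * ((\<integral>\<^sup>+z. ennreal ((h z)\<^sup>2) \<partial>measure_pmf p) + (\<integral>\<^sup>+z. ennreal ((h z)\<^sup>2) \<partial>measure_pmf q))"
    by (simp add: nn_integral_cmult nn_integral_add measure_pmf_eq_density nn_integral_density)
  also have "\<dots> = 2 * ennreal ((\<integral>z. (h z)\<^sup>2 \<partial>measure_pmf p) + (\<integral>z. (h z)\<^sup>2 \<partial>measure_pmf q))"
    using p2 q2 by (simp add: nn_integral_eq_integral)
  finally have "hellinger p q * (\<integral>\<^sup>+z. ennreal ((sqrt (pmf p z) + sqrt (pmf q z)) * \<bar>h z\<bar>) ^ 2 \<partial>?C)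
      \<le> hellinger p q * (2 * ennreal ((\<integral>z. (h z)\<^sup>2 \<partial>measure_pmf p) + (\<integral>z. (h z)\<^sup>2 \<partial>measure_pmf q)))"
    by (rule mult_left_mono) simp
  from order.trans[OF CS this] show ?thesis by (simp only: mult_ac)
qed

lemma pmf_entropy_map_inj:
  assumes "inj_on f (set_pmf p)"
  shows "pmf_entropy (map_pmf f p) = pmf_entropy p"
proof -
  have supp: "pmf_entropy r = (\<integral>\<^sup>+z. ennreal (- pmf r z * ln (pmf r z)) \<partial>count_space (set_pmf r))" for r :: "'c pmf"
    unfolding pmf_entropy_def
    by (intro nn_integral_count_space_eq) (auto simp: set_pmf_iff)
  have "pmf_entropy (map_pmf f p) = (\<integral>\<^sup>+z. ennreal (- pmf (map_pmf f p) (f z) * ln (pmf (map_pmf f p) (f z))) \<partial>count_space (set_pmf p))"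
    unfolding supp by (subst nn_integral_bij_count_space[of f "set_pmf p", symmetric])
      (use assms in \<open>auto simp: bij_betw_def\<close>)
  also have "\<dots> = pmf_entropy p"
    unfolding supp by (intro nn_integral_cong) (simp add: pmf_map_inj[OF assms])
  finally show ?thesis .
qed

text \<open>Gibbs' inequality with a weight \<open>r\<close> that is not normalised; the first
  summand pays for its total mass.\<close>

lemma pmf_entropy_le_cross_entropy:
  fixes r :: "'a \<Rightarrow> real"
  assumes "\<And>z. z \<in> set_pmf p \<Longrightarrow> 0 < r z \<and> r z \<le> 1"
  shows "pmf_entropy p \<le> (\<integral>\<^sup>+z. ennreal (r z) \<partial>count_space (set_pmf p)) + (\<integral>\<^sup>+z. ennreal (- ln (r z)) \<partial>measure_pmf p)"
proof -
  have "pmf_entropy p = (\<integral>\<^sup>+z. ennreal (- pmf p z * ln (pmf p z)) \<partial>count_space (set_pmf p))"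
    unfolding pmf_entropy_def
    by (intro nn_integral_count_space_eq) (auto simp: set_pmf_iff)
  also have "\<dots> \<le> (\<integral>\<^sup>+z. (ennreal (r z) + ennreal (pmf p z) * ennreal (- ln (r z))) \<partial>count_space (set_pmf p))"
  proof (intro nn_integral_mono)
    fix z assume "z \<in> space (count_space (set_pmf p))"
    then have r: "0 < r z" "r z \<le> 1" using assms by auto
    have "0 \<le> pmf p z * ln (pmf p z) - pmf p z + r z - pmf p z * ln (r z)"
      using sqrt_diff_square_le[of "pmf p z" "r z"] r zero_le_power2[of "sqrt (pmf p z) - sqrt (r z)"]
      by (smt (verit) pmf_nonneg)
    then have "- pmf p z * ln (pmf p z) \<le> r z + pmf p z * (- ln (r z))"
      by (smt (verit) minus_mult_minus mult_minus_left pmf_nonneg)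
    then show "ennreal (- pmf p z * ln (pmf p z)) \<le> ennreal (r z) + ennreal (pmf p z) * ennreal (- ln (r z))"
      using r by (simp flip: ennreal_mult ennreal_plus add: ennreal_leI mult_nonneg_nonpos)
  qed
  also have "\<dots> = (\<integral>\<^sup>+z. ennreal (r z) \<partial>count_space (set_pmf p))
       + (\<integral>\<^sup>+z. ennreal (pmf p z) * ennreal (- ln (r z)) \<partial>count_space (set_pmf p))"
    by (simp add: nn_integral_add)
  also have "(\<integral>\<^sup>+z. ennreal (pmf p z) * ennreal (- ln (r z)) \<partial>count_space (set_pmf p))
      = (\<integral>\<^sup>+z. ennreal (pmf p z) * ennreal (- ln (r z)) \<partial>count_space UNIV)"
    by (intro nn_integral_count_space_eq) (auto simp: set_pmf_iff)
  finally show ?thesis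
    by (simp add: measure_pmf_eq_density nn_integral_density)
qed

text \<open>Otherwise increments above K/(n+1) from some index on would add up to about K ln n and
  overtake the assumed growth. Applied both to the entropy and to the logarithm of the ball
  volume.\<close>

lemma log_growth_small_increments:
  fixes a :: "nat \<Rightarrow> real"
  assumes a: "\<And>n. n \<ge> 1 \<Longrightarrow> a n \<le> C + D * ln (real n)"
  shows "\<exists>K>0. \<exists>\<^sub>\<infinity>n. a (Suc n) - a n \<le> K / real (Suc n)"
proof -
  \<comment> \<open>One more than \<open>D\<close> leaves a surplus of one logarithm in the final
    comparison; the maximum with 0 keeps \<open>K\<close> positive.\<close>
  define K where "K = max 0 D + 1"
  have K: "K > 0" "K > D" "D \<le> K - 1" by (auto simp: K_def)
  have "\<exists>\<^sub>\<infinity>n. a (Suc n) - a n \<le> K / real (Suc n)"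
  proof (rule ccontr)
    assume "\<not> ?thesis"
    then obtain n0 where n0: "\<And>n. n \<ge> n0 \<Longrightarrow> a (Suc n) - a n > K / real (Suc n)"
      by (auto simp: not_INFM MOST_nat_le not_le)
    have step: "K / real (Suc n) \<ge> K * (ln (real (n + 2)) - ln (real (n + 1)))" for n
    proof -
      have e: "1 + 1 / real (n + 1) = real (n + 2) / real (n + 1)"
        by (simp add: field_simps)
      have "ln (real (n + 2)) - ln (real (n + 1)) = ln (1 + 1 / real (n + 1))"
        unfolding e by (subst ln_divide_pos) auto
      also have "\<dots> \<le> 1 / real (n + 1)" by (rule ln_add_one_self_le_self) auto
      finally show ?thesis using mult_left_mono[of _ "1 / real (n + 1)" K] K by simp
    qed
    have low: "a (n0 + m) \<ge> a n0 + K * (ln (real (n0 + m + 1)) - ln (real (n0 + 1)))" for m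
    proof (induction m)
      case (Suc m)
      have "a (Suc (n0 + m)) - a (n0 + m) \<ge> K * (ln (real (n0 + m + 2)) - ln (real (n0 + m + 1)))"
        using n0[of "n0 + m"] step[of "n0 + m"] by simp
      then show ?case using Suc by (simp add: algebra_simps)
    qed simp
    have "filterlim (\<lambda>m. ln (real (n0 + m + 1))) at_top sequentially"
      by real_asymp
    then have "\<forall>\<^sub>F m in sequentially. ln (real (n0 + m + 1)) > C - a n0 + K * ln (real (n0 + 1))"
      unfolding filterlim_at_top_dense by blast
    then have "\<forall>\<^sub>F m in sequentially. ln (real (n0 + m + 1)) > C - a n0 + K * ln (real (n0 + 1)) \<and> m \<ge> 1"
      using eventually_ge_at_top by (rule eventually_conj)
    then obtain m where m: "ln (real (n0 + m + 1)) > C - a n0 + K * ln (real (n0 + 1))" "m \<ge> 1"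
      using eventually_happens'[OF sequentially_bot] by blast
    define l where "l = ln (real (n0 + m + 1))"
    have "a (n0 + m) \<le> C + D * ln (real (n0 + m))" using a[of "n0+m"] m by simp
    also have "\<dots> \<le> C + (K - 1) * l"
    proof -
      have "0 \<le> ln (real (n0 + m))" using m by simp
      moreover have "ln (real (n0 + m)) \<le> l" using m by (simp add: l_def)
      ultimately have "D * ln (real (n0 + m)) \<le> (K - 1) * ln (real (n0+m))" "(K-1) * ln (real (n0+m)) \<le> (K-1) * l"
        using K by (auto simp: K_def intro!: mult_right_mono mult_left_mono)
      then show ?thesis by simp
    qed
    finally show False using low[of m] m by (simp add: l_def algebra_simps)
  qed
  then show ?thesis using K by blast
qed

text \<open>Tychonoff's theorem: the vectors of all values lie in a product of compact intervals, so
  they cluster. One refinement of \<open>F\<close> thus serves an index set of any size.\<close>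

lemma filter_limits_exist:
  fixes q :: "'i \<Rightarrow> nat \<Rightarrow> real"
  assumes "F \<noteq> bot" and bound: "\<And>i. \<forall>\<^sub>F n in F. \<bar>q i n\<bar> \<le> b i"
  shows "\<exists>F'. F' \<noteq> bot \<and> F' \<le> F \<and> (\<forall>i. \<exists>l. (q i \<longlongrightarrow> l) F')"
proof -
  \<comment> \<open>The bound holds only eventually, and from a point depending on \<open>i\<close>.
    Clamping puts every vector into the compact product and eventually changes nothing in each
    coordinate.\<close>
  define c where "c i n = max (- \<bar>b i\<bar>) (min \<bar>b i\<bar> (q i n))" for i n
  have "compactin (product_topology (\<lambda>i. euclidean) UNIV) (\<Pi>\<^sub>E i\<in>UNIV. {- \<bar>b i\<bar> .. \<bar>b i\<bar>})"
    by (auto simp: compactin_PiE)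
  then have comp: "compact (\<Pi>\<^sub>E i\<in>UNIV. {- \<bar>b i\<bar> .. \<bar>b i\<bar>})"
    by (simp add: euclidean_product_topology)
  define X where "X n = (\<lambda>i. c i n)" for n
  have "eventually (\<lambda>x. x \<in> (\<Pi>\<^sub>E i\<in>UNIV. {- \<bar>b i\<bar> .. \<bar>b i\<bar>})) (filtermap X F)"
    by (auto simp: eventually_filtermap X_def c_def intro!: always_eventually)
  moreover have "filtermap X F \<noteq> bot"
    using assms(1) by (simp add: filtermap_bot_iff)
  ultimately obtain l where l: "inf (nhds l) (filtermap X F) \<noteq> bot"
    using comp unfolding compact_filter by blast
  \<comment> \<open>\<open>F\<close> restricted to the indices whose vector is close to the cluster
    point \<open>l\<close>.\<close>
  define F' where "F' = inf F (filtercomap X (nhds l))"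
  have "F' \<noteq> bot"
  proof
    assume "F' = bot"
    then have "eventually (\<lambda>_. False) F'" by simp
    then obtain P Q where PQ: "eventually P F" "eventually Q (filtercomap X (nhds l))" "\<And>n. P n \<Longrightarrow> Q n \<Longrightarrow> False"
      unfolding F'_def eventually_inf by auto
    then obtain R where R: "eventually R (nhds l)" "\<And>n. R (X n) \<Longrightarrow> Q n"
      unfolding eventually_filtercomap by auto
    have "eventually (\<lambda>x. \<not> R x) (filtermap X F)"
      unfolding eventually_filtermap using PQ(1) by eventually_elim (use PQ R in auto)
    with R(1) have "eventually (\<lambda>_. False) (inf (nhds l) (filtermap X F))"
      unfolding eventually_inf by auto
    with l show False by (simp add: eventually_False)
  qed
  moreover have "F' \<le> F" by (simp add: F'_def)
  moreover have "(q i \<longlongrightarrow> l i) F'" for i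
  proof -
    have "filterlim X (nhds l) F'"
      unfolding F'_def by (meson filterlim_filtercomap filterlim_mono inf_le2 order_refl)
    then have "((\<lambda>n. X n i) \<longlongrightarrow> l i) F'"
      by (rule continuous_on_tendsto_compose[OF continuous_on_product_coordinates]) auto
    moreover have "\<forall>\<^sub>F n in F'. X n i = q i n"
      using filter_leD[OF \<open>F' \<le> F\<close> bound[of i]] by eventually_elim (auto simp: X_def c_def)
    ultimately show ?thesis by (simp add: tendsto_cong)
  qed
  ultimately show ?thesis by blast
qed

text \<open>Bridge from the summability over the carrier in which \<open>smooth\<close> and
  \<open>harmonic\<close> are phrased to Bochner integrals.\<close>

lemma pmf_integrable_iff_summable_on:
  fixes f :: "'a \<Rightarrow> 'b :: {banach, second_countable_topology}"
  assumes "set_pmf p \<subseteq> A"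
  shows "integrable (measure_pmf p) f \<longleftrightarrow> (\<lambda>x. norm (pmf p x *\<^sub>R f x)) summable_on A"
proof -
  have "integrable (measure_pmf p) f \<longleftrightarrow> Infinite_Set_Sum.abs_summable_on (\<lambda>x. pmf p x *\<^sub>R f x) UNIV"
    by (simp add: measure_pmf_eq_density integrable_density abs_summable_on_def)
  also have "\<dots> \<longleftrightarrow> Infinite_Set_Sum.abs_summable_on (\<lambda>x. pmf p x *\<^sub>R f x) A"
    using assms by (intro abs_summable_on_cong_neutral) (auto simp: set_pmf_iff)
  finally show ?thesis by (simp only: abs_summable_equivalent)
qed

lemma pmf_expectation_eq_infsum:
  fixes f :: "'a \<Rightarrow> 'b :: {banach, second_countable_topology}"
  assumes "set_pmf p \<subseteq> A" "integrable (measure_pmf p) f"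
  shows "(\<integral>x. f x \<partial>measure_pmf p) = (\<Sum>\<^sub>\<infinity>x\<in>A. pmf p x *\<^sub>R f x)"
proof -
  have "(\<integral>x. f x \<partial>measure_pmf p) = infsetsum (\<lambda>x. pmf p x *\<^sub>R f x) UNIV"
    by (simp add: measure_pmf_eq_density integral_density infsetsum_def)
  also have "\<dots> = infsetsum (\<lambda>x. pmf p x *\<^sub>R f x) A"
    using assms(1) by (intro infsetsum_cong_neutral) (auto simp: set_pmf_iff)
  also have "\<dots> = (\<Sum>\<^sub>\<infinity>x\<in>A. pmf p x *\<^sub>R f x)"
    using pmf_integrable_iff_summable_on[OF assms(1), of f] assms(2)
    by (intro infsetsum_infsum) (simp add: abs_summable_equivalent[symmetric])
  finally show ?thesis .
qed

lemma hellinger_le_2: "hellinger p q \<le> 2"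
proof -
  have "hellinger p q \<le> (\<integral>\<^sup>+z. (ennreal (pmf p z) + ennreal (pmf q z)) \<partial>count_space UNIV)"
    unfolding hellinger_def
    by (intro nn_integral_mono) (simp add: power2_diff flip: ennreal_plus add: ennreal_leI)
  also have "\<dots> = 2"
    by (simp add: nn_integral_add nn_integral_pmf flip: measure_pmf.emeasure_space_1)
  finally show ?thesis .
qed

section \<open>Word length and the entropy of the walk\<close>

context group
begin

lemma foldr_mult_closed:
  "set w \<subseteq> carrier G \<Longrightarrow> foldr (\<lambda>s y. s \<otimes> y) w \<one> \<in> carrier G"
  by (induction w) auto

lemma foldr_mult_append:
  "set v \<subseteq> carrier G \<Longrightarrow> set w \<subseteq> carrier G \<Longrightarrow>
   foldr (\<lambda>s y. s \<otimes> y) (v @ w) \<one> = foldr (\<lambda>s y. s \<otimes> y) v \<one> \<otimes> foldr (\<lambda>s y. s \<otimes> y) w \<one>"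
  by (induction v) (simp_all add: m_assoc foldr_mult_closed del: foldr_append)

lemma generating_word_exists:
  assumes S: "symmetric_generating_set G S" and x: "x \<in> carrier G"
  shows "\<exists>w. set w \<subseteq> S \<and> foldr (\<lambda>s y. s \<otimes> y) w \<one> = x"
proof -
  have SG: "S \<subseteq> carrier G" and inv: "\<And>s. s \<in> S \<Longrightarrow> inv s \<in> S" and "x \<in> generate G S"
    using S x by (auto simp: symmetric_generating_set_def)
  from this(3) show ?thesis
  proof (induction x)
    case one
    then show ?case by (intro exI[of _ "[]"]) auto
  next
    case (incl h)
    then show ?case using SG by (intro exI[of _ "[h]"]) auto
  next
    case (inv h)
    then show ?case using SG \<open>\<And>s. s \<in> S \<Longrightarrow> inv s \<in> S\<close> by (intro exI[of _ "[inv h]"]) auto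
  next
    case (eng h1 h2)
    then obtain v w where "set v \<subseteq> S" "foldr (\<lambda>s y. s \<otimes> y) v \<one> = h1"
      "set w \<subseteq> S" "foldr (\<lambda>s y. s \<otimes> y) w \<one> = h2" by blast
    then show ?case using SG foldr_mult_append[of v w]
      by (intro exI[of _ "v @ w"]) (auto simp del: foldr_append)
  qed
qed

lemma word_length_le: "set w \<subseteq> S \<Longrightarrow> word_length G S (foldr (\<lambda>s y. s \<otimes> y) w \<one>) \<le> length w"
  unfolding word_length_def by (rule Least_le) blast

lemma minimal_word_exists:
  assumes "symmetric_generating_set G S" and "x \<in> carrier G"
  obtains w where "set w \<subseteq> S" "length w = word_length G S x" "foldr (\<lambda>s y. s \<otimes> y) w \<one> = x"
proof -
  have "\<exists>n w. set w \<subseteq> S \<and> length w = n \<and> foldr (\<lambda>s y. s \<otimes> y) w \<one> = x"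
    using generating_word_exists[OF assms] by blast
  from LeastI_ex[OF this] show ?thesis using that unfolding word_length_def by blast
qed

lemma word_length_one: "word_length G S \<one> = 0"
  using word_length_le[of "[]" S] by simp

lemma word_length_mult:
  assumes "symmetric_generating_set G S" "x \<in> carrier G" "y \<in> carrier G"
  shows "word_length G S (x \<otimes> y) \<le> word_length G S x + word_length G S y"
proof -
  obtain v where v: "set v \<subseteq> S" "length v = word_length G S x" "foldr (\<lambda>s y. s \<otimes> y) v \<one> = x"
    using minimal_word_exists assms by metis
  obtain w where w: "set w \<subseteq> S" "length w = word_length G S y" "foldr (\<lambda>s y. s \<otimes> y) w \<one> = y"
    using minimal_word_exists assms by metis
  have "S \<subseteq> carrier G" using assms by (auto simp: symmetric_generating_set_def)
  then show ?thesis
    using word_length_le[of "v @ w" S] v w foldr_mult_append[of v w] by (auto simp del: foldr_append)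
qed

lemma word_length_generator:
  assumes "symmetric_generating_set G S" "s \<in> S"
  shows "word_length G S s \<le> 1"
  using word_length_le[of "[s]" S] assms by (auto simp: symmetric_generating_set_def)

lemma finite_word_ball:
  assumes "symmetric_generating_set G S" "finite S"
  shows "finite (word_ball G S n)"
proof (rule finite_subset)
  show "word_ball G S n \<subseteq> (\<lambda>w. foldr (\<lambda>s y. s \<otimes> y) w \<one>) ` {w. set w \<subseteq> S \<and> length w \<le> n}"
  proof
    fix x assume "x \<in> word_ball G S n"
    then have x: "x \<in> carrier G" "word_length G S x \<le> n" by (auto simp: word_ball_def)
    obtain w where "set w \<subseteq> S" "length w = word_length G S x" "foldr (\<lambda>s y. s \<otimes> y) w \<one> = x"
      using minimal_word_exists[OF assms(1) x(1)] .
    with x(2) show "x \<in> (\<lambda>w. foldr (\<lambda>s y. s \<otimes> y) w \<one>) ` {w. set w \<subseteq> S \<and> length w \<le> n}"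
      by (intro image_eqI[of _ _ w]) auto
  qed
  show "finite ((\<lambda>w. foldr (\<lambda>s y. s \<otimes> y) w \<one>) ` {w. set w \<subseteq> S \<and> length w \<le> n})"
    using finite_lists_length_le[OF assms(2)] by blast
qed

text \<open>Telescoping along the letters of a minimal word for \<open>y\<close>, starting from
  \<open>x\<close>.\<close>

lemma lipschitz_along_words:
  fixes h :: "'a \<Rightarrow> real"
  assumes S: "symmetric_generating_set G S"
    and h: "\<And>x s. x \<in> carrier G \<Longrightarrow> s \<in> S \<Longrightarrow> \<bar>h (x \<otimes> s) - h x\<bar> \<le> L"
    and x: "x \<in> carrier G" and y: "y \<in> carrier G"
  shows "\<bar>h (x \<otimes> y) - h x\<bar> \<le> L * real (word_length G S y)"
proof -
  have SG: "S \<subseteq> carrier G" using S by (auto simp: symmetric_generating_set_def)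
  have "\<bar>h (x \<otimes> foldr (\<lambda>s y. s \<otimes> y) w \<one>) - h x\<bar> \<le> L * real (length w)"
    if "set w \<subseteq> S" "x \<in> carrier G" for w x
    using that
  proof (induction w arbitrary: x)
    case (Cons s w)
    have "s \<in> carrier G" "foldr (\<lambda>s y. s \<otimes> y) w \<one> \<in> carrier G" using Cons SG foldr_mult_closed by auto
    then show ?case using Cons.IH[of "x \<otimes> s"] Cons.prems h[of x s]
      by (auto simp: m_assoc algebra_simps)
  qed simp
  then show ?thesis using minimal_word_exists[OF S y] x by metis
qed

end

section \<open>Moments and entropy of the random walk\<close>

locale growth_walk = group G for G :: "('a, 'b) monoid_scheme" (structure) +
  fixes S :: "'a set" and \<mu> :: "'a pmf"
  assumes finite_generators: "finite S" and generators: "symmetric_generating_set G S"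
    and growth: "polynomial_growth G S" and step_support: "set_pmf \<mu> \<subseteq> carrier G"
    and adapted: "adapted G \<mu>" and smooth: "smooth G S \<mu>"
begin

abbreviation len :: "'a \<Rightarrow> real" where "len x \<equiv> real (word_length G S x)"

lemma len_mult: "x \<in> carrier G \<Longrightarrow> y \<in> carrier G \<Longrightarrow> len (x \<otimes> y) \<le> len x + len y"
  using word_length_mult[OF generators, of x y] by linarith

lemma step_closed: "g \<in> set_pmf \<mu> \<Longrightarrow> g \<in> carrier G"
  using step_support by blast

text \<open>The exponential moment given by smoothness dominates the square, since t^2 / 2 <= exp t
  for t >= 0.\<close>

lemma step_second_moment: "integrable (measure_pmf \<mu>) (\<lambda>x. (len x)\<^sup>2)"
proof -
  obtain \<zeta> where z: "\<zeta> > 0" "(\<lambda>x. pmf \<mu> x * exp (\<zeta> * len x)) summable_on carrier G"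
    using smooth by (auto simp: smooth_def)
  have le: "(len x)\<^sup>2 \<le> 2 / \<zeta>\<^sup>2 * exp (\<zeta> * len x)" for x
  proof -
    have "(\<zeta> * len x)\<^sup>2 / 2 \<le> exp (\<zeta> * len x)"
      using exp_lower_Taylor_quadratic[of "\<zeta> * len x"] mult_nonneg_nonneg[of \<zeta> "len x"] z by linarith
    then show ?thesis using z by (simp add: field_simps power_mult_distrib)
  qed
  have "integrable (measure_pmf \<mu>) (\<lambda>x. exp (\<zeta> * len x))"
    using z(2) by (subst pmf_integrable_iff_summable_on[OF step_support]) simp
  then have "integrable (measure_pmf \<mu>) (\<lambda>x. 2 / \<zeta>\<^sup>2 * exp (\<zeta> * len x))" by simp
  then show ?thesis by (rule Bochner_Integration.integrable_bound) (use le in auto)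
qed

text \<open>The new step multiplies on the left, which makes \<open>walk (Suc n)\<close> literally
  the mixture of the left translates of \<open>walk n\<close>, as the entropy gap requires. The
  steps being independent and identically distributed, the law is the same as with steps on the
  right.\<close>

primrec walk :: "nat \<Rightarrow> 'a pmf" where
  "walk 0 = return_pmf \<one>"
| "walk (Suc n) = bind_pmf \<mu> (\<lambda>g. map_pmf (\<lambda>z. g \<otimes> z) (walk n))"

lemma walk_support: "set_pmf (walk n) \<subseteq> carrier G"
  by (induction n) (auto dest: step_closed)

lemma walk_closed: "z \<in> set_pmf (walk n) \<Longrightarrow> z \<in> carrier G"
  using walk_support by blast

lemma walk_second_moment: "integrable (measure_pmf (walk n)) (\<lambda>x. (len x)\<^sup>2)"
proof (induction n)
  case (Suc n)
  have "(\<integral>\<^sup>+x. ennreal ((len x)\<^sup>2) \<partial>measure_pmf (walk (Suc n)))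
      = (\<integral>\<^sup>+g. \<integral>\<^sup>+z. ennreal ((len (g \<otimes> z))\<^sup>2) \<partial>measure_pmf (walk n) \<partial>measure_pmf \<mu>)" by simp
  also have "\<dots> \<le> (\<integral>\<^sup>+g. \<integral>\<^sup>+z. (ennreal (2 * (len g)\<^sup>2) + ennreal (2 * (len z)\<^sup>2)) \<partial>measure_pmf (walk n) \<partial>measure_pmf \<mu>)"
  proof (intro nn_integral_mono_AE AE_pmfI)
    fix g z assume "g \<in> set_pmf \<mu>" "z \<in> set_pmf (walk n)"
    then have "len (g \<otimes> z) \<le> len g + len z" using step_closed walk_closed len_mult by blast
    then have "(len (g \<otimes> z))\<^sup>2 \<le> (len g + len z)\<^sup>2" by (intro power_mono) auto
    also have "\<dots> \<le> 2 * (len g)\<^sup>2 + 2 * (len z)\<^sup>2"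
      using sum_squares_bound[of "len g" "len z"] by (simp add: power2_sum)
    finally show "ennreal ((len (g \<otimes> z))\<^sup>2) \<le> ennreal (2 * (len g)\<^sup>2) + ennreal (2 * (len z)\<^sup>2)"
      by (simp flip: ennreal_plus add: ennreal_leI)
  qed
  also have "\<dots> = (\<integral>\<^sup>+g. ennreal (2 * (len g)\<^sup>2) \<partial>measure_pmf \<mu>) + (\<integral>\<^sup>+z. ennreal (2 * (len z)\<^sup>2) \<partial>measure_pmf (walk n))"
    by (simp add: nn_integral_add)
  also have "\<dots> < \<infinity>"
    using Suc step_second_moment by (simp add: nn_integral_eq_integral)
  finally show ?case by (simp add: integrable_iff_bounded del: walk.simps)
qed (simp add: integrable_measure_pmf_finite)

text \<open>The common integrability criterion: a majorant of the form constant plus quadratic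
  covers Lipschitz functions, their squares and products, and bounded functions.\<close>

lemma second_moment_integrable:
  fixes h :: "'a \<Rightarrow> real"
  assumes "set_pmf p \<subseteq> carrier G" "integrable (measure_pmf p) (\<lambda>x. (len x)\<^sup>2)"
    and "\<And>z. z \<in> carrier G \<Longrightarrow> \<bar>h z\<bar> \<le> A + B * (len z)\<^sup>2"
  shows "integrable (measure_pmf p) h"
proof (rule Bochner_Integration.integrable_bound)
  show "integrable (measure_pmf p) (\<lambda>z. A + B * (len z)\<^sup>2)" using assms by simp
  show "AE x in measure_pmf p. norm (h x) \<le> norm (A + B * (len x)\<^sup>2)"
    using assms by (force simp: AE_measure_pmf_iff)
qed simp

lemmas step_integrable = second_moment_integrable[OF step_support step_second_moment]
  and walk_integrable = second_moment_integrable[OF walk_support walk_second_moment]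

lemma walk_Suc_expectation:
  fixes h :: "'a \<Rightarrow> real"
  assumes "\<And>z. z \<in> carrier G \<Longrightarrow> \<bar>h z\<bar> \<le> A + B * (len z)\<^sup>2"
  shows "(\<integral>z. h z \<partial>walk (Suc n)) = (\<integral>g. \<integral>z. h (g \<otimes> z) \<partial>walk n \<partial>\<mu>)"
    and "integrable (measure_pmf \<mu>) (\<lambda>g. \<integral>z. h (g \<otimes> z) \<partial>walk n)"
  using bind_pmf_integral[of \<mu> "\<lambda>g. map_pmf (\<lambda>z. g \<otimes> z) (walk n)" h]
    bind_pmf_integrable[of \<mu> "\<lambda>g. map_pmf (\<lambda>z. g \<otimes> z) (walk n)" h] walk_integrable[of h A B "Suc n"] assms
  by auto

text \<open>True because lengths are integers; written with \<open>0 +\<close> and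
  \<open>1 *\<close> to fit the majorant of the integrability criterion.\<close>

lemma len_le_square: "\<bar>len z\<bar> \<le> 0 + 1 * (len z)\<^sup>2"
  by (cases "word_length G S z") (auto simp: power2_eq_square)

lemma walk_first_moment: "(\<integral>z. len z \<partial>walk n) \<le> real n * (\<integral>g. len g \<partial>\<mu>)"
proof (induction n)
  case 0
  then show ?case by (simp add: word_length_one)
next
  case (Suc n)
  have il: "integrable (measure_pmf (walk n)) len" "integrable (measure_pmf \<mu>) len"
    by (rule walk_integrable step_integrable, rule len_le_square)+
  have "(\<integral>z. len z \<partial>walk (Suc n)) = (\<integral>g. \<integral>z. len (g \<otimes> z) \<partial>walk n \<partial>\<mu>)"
    by (rule walk_Suc_expectation) (rule len_le_square)
  also have "\<dots> \<le> (\<integral>g. len g + (\<integral>z. len z \<partial>walk n) \<partial>\<mu>)"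
  proof (intro integral_mono_AE AE_pmfI)
    show "integrable (measure_pmf \<mu>) (\<lambda>g. \<integral>z. len (g \<otimes> z) \<partial>walk n)"
      by (rule walk_Suc_expectation) (rule len_le_square)
    fix g assume g: "g \<in> set_pmf \<mu>"
    have "(\<integral>z. len (g \<otimes> z) \<partial>walk n) \<le> (\<integral>z. len g + len z \<partial>walk n)"
    proof (intro integral_mono_AE AE_pmfI)
      have ge: "len (g \<otimes> z) \<le> len g + len z" if "z \<in> carrier G" for z
        using that g step_closed len_mult by blast
      show "integrable (measure_pmf (walk n)) (\<lambda>z. len (g \<otimes> z))"
      proof (rule walk_integrable[of _ "len g" 1])
        fix z assume "z \<in> carrier G"
        then show "\<bar>len (g \<otimes> z)\<bar> \<le> len g + 1 * (len z)\<^sup>2"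
          using ge[of z] len_le_square[of z] by linarith
      qed
      show "\<And>z. z \<in> set_pmf (walk n) \<Longrightarrow> len (g \<otimes> z) \<le> len g + len z" using ge walk_closed by blast
    qed (use il in auto)
    then show "(\<integral>z. len (g \<otimes> z) \<partial>walk n) \<le> len g + (\<integral>z. len z \<partial>walk n)" using il by simp
  qed (use il in auto)
  also have "\<dots> \<le> real (Suc n) * (\<integral>g. len g \<partial>\<mu>)" using Suc il by (simp add: algebra_simps)
  finally show ?case .
qed

lemma word_ball_card_bound:
  obtains C d where "C > 0" "\<And>n. real (card (word_ball G S n)) \<le> C * real (Suc n) ^ d"
proof -
  obtain C d where C: "\<And>n. n \<ge> 1 \<Longrightarrow> real (card (word_ball G S n)) \<le> C * real n ^ d"
    using growth by (auto simp: polynomial_growth_def)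
  show ?thesis
  proof
    show "max C 1 > 0" by simp
    fix n
    have "card (word_ball G S n) \<le> card (word_ball G S (Suc n))"
      by (intro card_mono finite_word_ball[OF generators finite_generators]) (auto simp: word_ball_def)
    then have "real (card (word_ball G S n)) \<le> C * real (Suc n) ^ d" using C[of "Suc n"] by simp
    also have "\<dots> \<le> max C 1 * real (Suc n) ^ d" by (intro mult_right_mono) auto
    finally show "real (card (word_ball G S n)) \<le> max C 1 * real (Suc n) ^ d" .
  qed
qed

text \<open>The sphere of radius k has at most C (k+1)^d points, so the exponent d + 2 leaves the
  summable bound C/(k+1)^2. These weights are the reference measure for the entropy of the
  walk.\<close>

lemma power_weights_summable:
  obtains d :: nat where "(\<integral>\<^sup>+z. ennreal (1 / (1 + len z) ^ d) \<partial>count_space (carrier G)) < \<infinity>"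
proof -
  obtain C d where C: "C > 0" "\<And>n. real (card (word_ball G S n)) \<le> C * real (Suc n) ^ d"
    using word_ball_card_bound by blast
  have "(\<integral>\<^sup>+z. ennreal (1 / (1 + len z) ^ (d + 2)) \<partial>count_space (carrier G))
      = (\<integral>\<^sup>+z. (\<Sum>k. ennreal (1 / (1 + real k) ^ (d + 2)) * indicator {x. word_length G S x = k} z) \<partial>count_space (carrier G))"
  proof (intro nn_integral_cong)
    fix z
    have "(\<Sum>k. ennreal (1 / (1 + real k) ^ (d + 2)) * indicator {x. word_length G S x = k} z)
        = (\<Sum>k\<in>{word_length G S z}. ennreal (1 / (1 + real k) ^ (d + 2)) * indicator {x. word_length G S x = k} z)"
      by (intro suminf_finite) auto
    then show "ennreal (1 / (1 + len z) ^ (d + 2)) = (\<Sum>k. ennreal (1 / (1 + real k) ^ (d + 2)) * indicator {x. word_length G S x = k} z)"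
      by simp
  qed
  also have "\<dots> = (\<Sum>k. \<integral>\<^sup>+z. ennreal (1 / (1 + real k) ^ (d + 2)) * indicator {x. word_length G S x = k} z \<partial>count_space (carrier G))"
    by (intro nn_integral_suminf) auto
  also have "\<dots> \<le> (\<Sum>k. ennreal (C * (1 / real (Suc k) ^ 2)))"
  proof (intro suminf_le summableI)
    fix k
    have sub: "{x \<in> carrier G. word_length G S x = k} \<subseteq> word_ball G S k" by (auto simp: word_ball_def)
    have fin: "finite (word_ball G S k)" by (rule finite_word_ball[OF generators finite_generators])
    have "(\<integral>\<^sup>+z. ennreal (1 / (1 + real k) ^ (d + 2)) * indicator {x. word_length G S x = k} z \<partial>count_space (carrier G))
       = (\<integral>\<^sup>+z. ennreal (1 / (1 + real k) ^ (d + 2)) * indicator {x \<in> carrier G. word_length G S x = k} z \<partial>count_space (carrier G))"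
      by (intro nn_integral_cong) (auto simp: indicator_def)
    also have "\<dots> = ennreal (1 / (1 + real k) ^ (d + 2)) * emeasure (count_space (carrier G)) {x \<in> carrier G. word_length G S x = k}"
      by (rule nn_integral_cmult_indicator) auto
    also have "\<dots> = ennreal (1 / (1 + real k) ^ (d + 2)) * ennreal (real (card {x \<in> carrier G. word_length G S x = k}))"
      using finite_subset[OF sub fin] by (simp add: emeasure_count_space_finite ennreal_of_nat_eq_real_of_nat)
    also have "\<dots> = ennreal (1 / (1 + real k) ^ (d + 2) * real (card {x \<in> carrier G. word_length G S x = k}))"
      by (subst ennreal_mult[symmetric]) auto
    also have "\<dots> \<le> ennreal (C * (1 / real (Suc k) ^ 2))"
    proof (rule ennreal_leI)
      have "real (card {x \<in> carrier G. word_length G S x = k}) \<le> C * real (Suc k) ^ d"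
        using card_mono[OF fin sub] C(2)[of k] by linarith
      then have "1 / (1 + real k) ^ (d + 2) * real (card {x \<in> carrier G. word_length G S x = k})
          \<le> 1 / (1 + real k) ^ (d + 2) * (C * (1 + real k) ^ d)"
        by (intro mult_left_mono) (auto simp: add.commute)
      also have "\<dots> = C * (1 / real (Suc k) ^ 2)"
      proof -
        have "1 / t ^ (d + 2) * (C * t ^ d) = C * (1 / t ^ 2)" if "t > 0" for t :: real
          using that by (simp add: power_add power2_eq_square)
        from this[of "1 + real k"] show ?thesis by (simp add: add.commute)
      qed
      finally show "1 / (1 + real k) ^ (d + 2) * real (card {x \<in> carrier G. word_length G S x = k}) \<le> C * (1 / real (Suc k) ^ 2)" .
    qed
    finally show "(\<integral>\<^sup>+z. ennreal (1 / (1 + real k) ^ (d + 2)) * indicator {x. word_length G S x = k} z \<partial>count_space (carrier G))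
       \<le> ennreal (C * (1 / real (Suc k) ^ 2))" .
  qed
  also have "\<dots> < \<infinity>"
  proof -
    have "summable (\<lambda>k. C * (1 / real (Suc k) ^ 2))"
      using inverse_power_summable[of 2, where 'a=real] summable_Suc_iff[of "\<lambda>k. inverse (real k ^ 2)"]
      by (intro summable_mult) (simp add: inverse_eq_divide)
    then show ?thesis using C by (simp add: suminf_ennreal2)
  qed
  finally show ?thesis using that by blast
qed

text \<open>Gibbs' inequality against polynomially decaying weights reduces the entropy to the mean
  of \<open>ln (1 + len z)\<close>, and the first moment of the walk is at most linear.\<close>

lemma walk_entropy_log_bound:
  obtains C D where "\<And>n. n \<ge> 1 \<Longrightarrow> pmf_entropy (walk n) \<le> ennreal (C + D * ln (real n))"
    "0 \<le> C" "0 \<le> D"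
proof -
  obtain d where d: "(\<integral>\<^sup>+z. ennreal (1 / (1 + len z) ^ d) \<partial>count_space (carrier G)) < \<infinity>"
    using power_weights_summable by blast
  then obtain R where R: "(\<integral>\<^sup>+z. ennreal (1 / (1 + len z) ^ d) \<partial>count_space (carrier G)) = ennreal R" "R \<ge> 0"
    by (cases "\<integral>\<^sup>+z. ennreal (1 / (1 + len z) ^ d) \<partial>count_space (carrier G)") auto
  define m where "m = (\<integral>g. len g \<partial>\<mu>)"
  have m: "m \<ge> 0" by (simp add: m_def)
  have "pmf_entropy (walk n) \<le> ennreal ((R + d * m) + d * ln (real n))" if n: "n \<ge> 1" for n
  proof -
    have il: "integrable (measure_pmf (walk n)) len" by (rule walk_integrable, rule len_le_square)
    have split: "pmf_entropy (walk n) \<le> (\<integral>\<^sup>+z. ennreal (1 / (1 + len z) ^ d) \<partial>count_space (set_pmf (walk n)))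
        + (\<integral>\<^sup>+z. ennreal (- ln (1 / (1 + len z) ^ d)) \<partial>measure_pmf (walk n))"
      by (rule pmf_entropy_le_cross_entropy) auto
    have weights: "(\<integral>\<^sup>+z. ennreal (1 / (1 + len z) ^ d) \<partial>count_space (set_pmf (walk n))) \<le> ennreal R"
      unfolding R(1)[symmetric]
      by (subst (1 2) nn_integral_count_space_indicator)
        (auto intro!: nn_integral_mono dest: walk_closed simp: indicator_def)
    \<comment> \<open>The tangent to \<open>ln\<close> at \<open>n\<close> bounds
      \<open>ln (1 + len z)\<close> by a function affine in \<open>len z\<close>; its mean exceeds
      \<open>ln n\<close> by at most \<open>m\<close>, because the first moment is at most
      \<open>n * m\<close>.\<close>
    have "(\<integral>\<^sup>+z. ennreal (- ln (1 / (1 + len z) ^ d)) \<partial>measure_pmf (walk n))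
       \<le> (\<integral>\<^sup>+z. ennreal (real d * (ln (real n) + (1 + len z) / real n - 1)) \<partial>measure_pmf (walk n))"
    proof (intro nn_integral_mono ennreal_leI)
      fix z
      have "ln ((1 + len z) / real n) \<le> (1 + len z) / real n - 1"
        using n by (intro ln_le_minus_one) auto
      then have "ln (1 + len z) \<le> ln (real n) + (1 + len z) / real n - 1"
        using n by (subst (asm) ln_divide_pos) auto
      moreover have "- ln (1 / (1 + len z) ^ d) = real d * ln (1 + len z)"
        by (subst ln_divide_pos) (auto simp: ln_realpow)
      ultimately show "- ln (1 / (1 + len z) ^ d) \<le> real d * (ln (real n) + (1 + len z) / real n - 1)"
        by (metis mult_left_mono of_nat_0_le_iff)
    qed
    also have "\<dots> = ennreal (\<integral>z. real d * (ln (real n) + (1 + len z) / real n - 1) \<partial>walk n)"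
    proof (intro nn_integral_eq_integral AE_I2 mult_nonneg_nonneg)
      fix z
      have "ln ((1 + len z) / real n) \<le> (1 + len z) / real n - 1"
        using n by (intro ln_le_minus_one) auto
      then have "ln (1 + len z) \<le> ln (real n) + (1 + len z) / real n - 1"
        using n by (subst (asm) ln_divide_pos) auto
      moreover have "0 \<le> ln (1 + len z)" by simp
      ultimately show "0 \<le> ln (real n) + (1 + len z) / real n - 1" by linarith
    qed (use il in auto)
    finally have cross: "(\<integral>\<^sup>+z. ennreal (- ln (1 / (1 + len z) ^ d)) \<partial>measure_pmf (walk n))
       \<le> ennreal (\<integral>z. real d * (ln (real n) + (1 + len z) / real n - 1) \<partial>walk n)" .
    have "(\<integral>z. real d * (ln (real n) + (1 + len z) / real n - 1) \<partial>walk n)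
        = real d * (ln (real n) + (1 + (\<integral>z. len z \<partial>walk n)) / real n - 1)"
      using il by simp
    also have "\<dots> \<le> real d * (ln (real n) + m)"
    proof (intro mult_left_mono)
      have "(1 + (\<integral>z. len z \<partial>walk n)) / real n \<le> (1 + real n * m) / real n"
        using walk_first_moment[of n] by (intro divide_right_mono) (auto simp: m_def)
      also have "\<dots> \<le> 1 + m" using n by (simp add: field_simps)
      finally show "ln (real n) + (1 + (\<integral>z. len z \<partial>walk n)) / real n - 1 \<le> ln (real n) + m" by simp
    qed auto
    finally have "ennreal (\<integral>z. real d * (ln (real n) + (1 + len z) / real n - 1) \<partial>walk n)
        \<le> ennreal (real d * (ln (real n) + m))" by (rule ennreal_leI)
    then have "pmf_entropy (walk n) \<le> ennreal R + ennreal (real d * (ln (real n) + m))"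
      using split weights cross by (meson add_mono order.trans)
    also have "\<dots> = ennreal ((R + d * m) + d * ln (real n))"
      using R m n by (subst ennreal_plus[symmetric]) (auto simp: algebra_simps)
    finally show ?thesis .
  qed
  moreover have "0 \<le> R + d * m" using R m by simp
  ultimately show ?thesis using that by (meson of_nat_0_le_iff)
qed

text \<open>Compares a component of the mixture with the mixture itself, hence the time shift. The
  distance is at most 2, so \<open>enn2real\<close> loses nothing.\<close>

definition step_hellinger :: "nat \<Rightarrow> 'a \<Rightarrow> real" where
  "step_hellinger n g = enn2real (hellinger (map_pmf (\<lambda>z. g \<otimes> z) (walk n)) (walk (Suc n)))"

lemma step_hellinger_nonneg: "0 \<le> step_hellinger n g"
  by (simp add: step_hellinger_def)

lemma ennreal_step_hellinger:
  "ennreal (step_hellinger n g) = hellinger (map_pmf (\<lambda>z. g \<otimes> z) (walk n)) (walk (Suc n))"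
proof -
  have "hellinger (map_pmf (\<lambda>z. g \<otimes> z) (walk n)) (walk (Suc n)) < \<infinity>"
    by (rule le_less_trans[OF hellinger_le_2]) simp
  then show ?thesis unfolding step_hellinger_def by (simp del: walk.simps)
qed

text \<open>Translation by a step preserves entropy, so the mean distance is at most one entropy
  increment, which is O(1/n) infinitely often. Finite sums are the form that survives a termwise
  limit.\<close>

lemma step_hellinger_decay:
  obtains K where "K > 0"
    "\<exists>\<^sub>\<infinity>n. \<forall>A. finite A \<longrightarrow> (\<Sum>g\<in>A. pmf \<mu> g * step_hellinger n g) \<le> K / real (Suc n)"
proof -
  obtain C D where CD: "\<And>n. n \<ge> 1 \<Longrightarrow> pmf_entropy (walk n) \<le> ennreal (C + D * ln (real n))"
    "0 \<le> C" "0 \<le> D" using walk_entropy_log_bound by blast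
  define H where "H n = enn2real (pmf_entropy (walk n))" for n
  have gap: "(\<integral>\<^sup>+g. ennreal (step_hellinger n g) \<partial>measure_pmf \<mu>) + pmf_entropy (walk n) \<le> pmf_entropy (walk (Suc n))" for n
  proof -
    have "(\<integral>\<^sup>+g. pmf_entropy (map_pmf (\<lambda>z. g \<otimes> z) (walk n)) \<partial>measure_pmf \<mu>) = (\<integral>\<^sup>+g. pmf_entropy (walk n) \<partial>measure_pmf \<mu>)"
    proof (intro nn_integral_cong_AE AE_pmfI pmf_entropy_map_inj inj_onI)
      fix g x y assume "g \<in> set_pmf \<mu>" "x \<in> set_pmf (walk n)" "y \<in> set_pmf (walk n)" "g \<otimes> x = g \<otimes> y"
      then show "x = y" using step_closed walk_closed by (metis Units_eq Units_l_cancel)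
    qed
    then show ?thesis
      using hellinger_le_entropy_gap[of \<mu> "\<lambda>g. map_pmf (\<lambda>z. g \<otimes> z) (walk n)"]
      by (simp add: ennreal_step_hellinger del: nn_integral_map_pmf)
  qed
  have fin: "pmf_entropy (walk n) < \<infinity>" for n
  proof (cases n)
    \<comment> \<open>The logarithmic bound starts at \<open>n = 1\<close>; at 0 it is replaced by
      the fact that a step does not decrease entropy.\<close>
    case 0
    have "pmf_entropy (walk 0) \<le> pmf_entropy (walk (Suc 0))"
      by (rule order.trans[OF _ gap[of 0]]) (simp add: add_increasing del: walk.simps)
    also have "\<dots> < \<infinity>" by (rule le_less_trans[OF CD(1)]) auto
    finally show ?thesis using 0 by simp
  next
    case (Suc m)
    then have "n \<ge> 1" by simp
    from CD(1)[OF this] show ?thesis by (rule le_less_trans) simp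
  qed
  have eH: "pmf_entropy (walk n) = ennreal (H n)" for n
    using fin[of n] by (simp add: H_def)
  have "H n \<le> C + D * ln (real n)" if "n \<ge> 1" for n
    using CD(1)[OF that] CD(2,3) that unfolding eH by (subst (asm) ennreal_le_iff) auto
  then obtain K where K: "K > 0" "\<exists>\<^sub>\<infinity>n. H (Suc n) - H n \<le> K / real (Suc n)"
    using log_growth_small_increments[of H C D] by blast
  have "(\<Sum>g\<in>A. pmf \<mu> g * step_hellinger n g) \<le> H (Suc n) - H n" if A: "finite A" for A n
  proof -
    have "ennreal (\<Sum>g\<in>A. pmf \<mu> g * step_hellinger n g) = (\<Sum>g\<in>A. ennreal (pmf \<mu> g * step_hellinger n g))"
      by (rule sum_ennreal[symmetric]) (simp add: step_hellinger_nonneg)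
    also have "\<dots> = (\<integral>\<^sup>+g. ennreal (pmf \<mu> g * step_hellinger n g) \<partial>count_space A)"
      using A by (simp add: nn_integral_count_space_finite)
    also have "\<dots> \<le> (\<integral>\<^sup>+g. ennreal (pmf \<mu> g * step_hellinger n g) \<partial>count_space UNIV)"
      by (subst nn_integral_count_space_indicator) (auto intro!: nn_integral_mono simp: indicator_def)
    also have "\<dots> = (\<integral>\<^sup>+g. ennreal (step_hellinger n g) \<partial>measure_pmf \<mu>)"
      by (simp add: measure_pmf_eq_density nn_integral_density ennreal_mult step_hellinger_nonneg)
    finally have "ennreal (\<Sum>g\<in>A. pmf \<mu> g * step_hellinger n g) + ennreal (H n) \<le> ennreal (H (Suc n))"
      using gap[of n] unfolding eH by (meson add_right_mono order.trans)
    moreover have "0 \<le> H n" "0 \<le> H (Suc n)" "0 \<le> (\<Sum>g\<in>A. pmf \<mu> g * step_hellinger n g)"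
      by (auto simp: H_def sum_nonneg step_hellinger_nonneg)
    ultimately show ?thesis by (simp flip: ennreal_plus)
  qed
  then have "\<exists>\<^sub>\<infinity>n. \<forall>A. finite A \<longrightarrow> (\<Sum>g\<in>A. pmf \<mu> g * step_hellinger n g) \<le> K / real (Suc n)"
    by (intro INFM_mono[OF K(2)]) (blast intro: order.trans)
  then show ?thesis using that K(1) by blast
qed

end

section \<open>Second moments of Lipschitz harmonic functions\<close>

context growth_walk
begin

text \<open>Functions are normalised to vanish at \<open>\<one>\<close> and off the carrier, so that constants are factored out
  and the identities between translates hold as equations of functions.\<close>

definition lip_harmonic :: "('a \<Rightarrow> real) set" where
  "lip_harmonic = {h. (\<forall>z. z \<notin> carrier G \<longrightarrow> h z = 0) \<and> h \<one> = 0 \<and>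
     (\<forall>k\<in>carrier G. (\<integral>g. h (k \<otimes> g) \<partial>\<mu>) = h k) \<and>
     (\<exists>L. \<forall>x\<in>carrier G. \<forall>y\<in>carrier G. \<bar>h (x \<otimes> y) - h x\<bar> \<le> L * len y)}"

definition translate :: "'a \<Rightarrow> ('a \<Rightarrow> real) \<Rightarrow> 'a \<Rightarrow> real" where
  "translate x h = (\<lambda>y. if y \<in> carrier G then h (x \<otimes> y) - h x else 0)"

text \<open>For a Lipschitz harmonic \<open>h\<close>, \<open>energy (translate x h)\<close> is the
  variance of the martingale increment made by one step from \<open>x\<close>.\<close>

definition energy :: "('a \<Rightarrow> real) \<Rightarrow> real" where
  "energy h = (\<integral>g. (h g)\<^sup>2 \<partial>\<mu>)"

lemma lip_harmonicI:
  assumes "\<And>z. z \<notin> carrier G \<Longrightarrow> h z = 0" "h \<one> = 0"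
    and "\<And>k. k \<in> carrier G \<Longrightarrow> (\<integral>g. h (k \<otimes> g) \<partial>\<mu>) = h k"
    and "\<And>x y. x \<in> carrier G \<Longrightarrow> y \<in> carrier G \<Longrightarrow> \<bar>h (x \<otimes> y) - h x\<bar> \<le> L * len y"
  shows "h \<in> lip_harmonic"
  using assms unfolding lip_harmonic_def by blast

lemma lip_harmonic_outside: "h \<in> lip_harmonic \<Longrightarrow> z \<notin> carrier G \<Longrightarrow> h z = 0"
  and lip_harmonic_one: "h \<in> lip_harmonic \<Longrightarrow> h \<one> = 0"
  and lip_harmonic_mean: "h \<in> lip_harmonic \<Longrightarrow> k \<in> carrier G \<Longrightarrow> (\<integral>g. h (k \<otimes> g) \<partial>\<mu>) = h k"
  by (auto simp: lip_harmonic_def)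

lemma lip_harmonic_lipschitz:
  assumes "h \<in> lip_harmonic"
  obtains L where "L \<ge> 0" "\<And>x y. x \<in> carrier G \<Longrightarrow> y \<in> carrier G \<Longrightarrow> \<bar>h (x \<otimes> y) - h x\<bar> \<le> L * len y"
proof -
  obtain L where L: "\<And>x y. x \<in> carrier G \<Longrightarrow> y \<in> carrier G \<Longrightarrow> \<bar>h (x \<otimes> y) - h x\<bar> \<le> L * len y"
    using assms unfolding lip_harmonic_def by blast
  have "\<bar>h (x \<otimes> y) - h x\<bar> \<le> max L 0 * len y" if "x \<in> carrier G" "y \<in> carrier G" for x y
    by (rule order.trans[OF L[OF that]]) (intro mult_right_mono; simp)
  then show ?thesis using that[of "max L 0"] by auto
qed

lemma quadratic_bound:
  assumes "0 \<le> L" "\<bar>a - b\<bar> \<le> L * len y"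
  shows "\<bar>a\<bar> \<le> \<bar>b\<bar> + L * (len y)\<^sup>2"
  using assms mult_left_mono[of "len y" "(len y)\<^sup>2" L] len_le_square[of y] by linarith

lemma lip_harmonic_growth:
  assumes "h \<in> lip_harmonic"
  obtains L where "L \<ge> 0" "\<And>z. z \<in> carrier G \<Longrightarrow> \<bar>h z\<bar> \<le> L * len z"
proof -
  obtain L where L: "L \<ge> 0" "\<And>x y. x \<in> carrier G \<Longrightarrow> y \<in> carrier G \<Longrightarrow> \<bar>h (x \<otimes> y) - h x\<bar> \<le> L * len y"
    using lip_harmonic_lipschitz[OF assms] by blast
  then show ?thesis using that[of L] L(2)[of \<one>] lip_harmonic_one[OF assms] by auto
qed

lemma lip_harmonic_translated_bound:
  assumes "h \<in> lip_harmonic" "x \<in> carrier G"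
  obtains A B where "\<And>z. z \<in> carrier G \<Longrightarrow> \<bar>h (x \<otimes> z)\<bar> \<le> A + B * (len z)\<^sup>2"
proof -
  obtain L where L: "L \<ge> 0" "\<And>x y. x \<in> carrier G \<Longrightarrow> y \<in> carrier G \<Longrightarrow> \<bar>h (x \<otimes> y) - h x\<bar> \<le> L * len y"
    using lip_harmonic_lipschitz[OF assms(1)] by blast
  show ?thesis using that quadratic_bound[OF L(1) L(2)[OF assms(2)]] by blast
qed

lemma lip_harmonic_product_bound:
  assumes "h \<in> lip_harmonic" "k \<in> lip_harmonic"
  obtains B where "\<And>z. z \<in> carrier G \<Longrightarrow> \<bar>h z * k z\<bar> \<le> 0 + B * (len z)\<^sup>2"
proof -
  obtain L where L: "L \<ge> 0" "\<And>z. z \<in> carrier G \<Longrightarrow> \<bar>h z\<bar> \<le> L * len z"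
    using lip_harmonic_growth[OF assms(1)] by blast
  obtain M where M: "M \<ge> 0" "\<And>z. z \<in> carrier G \<Longrightarrow> \<bar>k z\<bar> \<le> M * len z"
    using lip_harmonic_growth[OF assms(2)] by blast
  have "\<bar>h z * k z\<bar> \<le> 0 + L * M * (len z)\<^sup>2" if "z \<in> carrier G" for z
    using mult_mono[OF L(2)[OF that] M(2)[OF that]] L M by (simp add: abs_mult power2_eq_square mult_ac)
  then show ?thesis using that by blast
qed

lemma lip_harmonic_integrable:
  assumes "h \<in> lip_harmonic" "x \<in> carrier G"
  shows "integrable (measure_pmf \<mu>) (\<lambda>z. h (x \<otimes> z))" "integrable (measure_pmf (walk n)) (\<lambda>z. h (x \<otimes> z))"
proof -
  obtain A B where b: "\<And>z. z \<in> carrier G \<Longrightarrow> \<bar>h (x \<otimes> z)\<bar> \<le> A + B * (len z)\<^sup>2"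
    using lip_harmonic_translated_bound[OF assms] by blast
  show "integrable (measure_pmf \<mu>) (\<lambda>z. h (x \<otimes> z))" by (rule step_integrable[OF b])
  show "integrable (measure_pmf (walk n)) (\<lambda>z. h (x \<otimes> z))" by (rule walk_integrable[OF b])
qed

lemma lip_harmonic_product_integrable:
  assumes "h \<in> lip_harmonic" "k \<in> lip_harmonic"
  shows "integrable (measure_pmf \<mu>) (\<lambda>z. h z * k z)" "integrable (measure_pmf (walk n)) (\<lambda>z. h z * k z)"
proof -
  obtain B where b: "\<And>z. z \<in> carrier G \<Longrightarrow> \<bar>h z * k z\<bar> \<le> 0 + B * (len z)\<^sup>2"
    using lip_harmonic_product_bound[OF assms] by blast
  show "integrable (measure_pmf \<mu>) (\<lambda>z. h z * k z)" by (rule step_integrable[OF b])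
  show "integrable (measure_pmf (walk n)) (\<lambda>z. h z * k z)" by (rule walk_integrable[OF b])
qed

lemma lip_harmonic_square_integrable:
  assumes "h \<in> lip_harmonic"
  shows "integrable (measure_pmf \<mu>) (\<lambda>z. (h z)\<^sup>2)" "integrable (measure_pmf (walk n)) (\<lambda>z. (h z)\<^sup>2)"
  using lip_harmonic_product_integrable[OF assms assms] by (auto simp: power2_eq_square)

lemma lip_harmonic_integrable':
  assumes "h \<in> lip_harmonic"
  shows "integrable (measure_pmf (walk n)) h"
proof -
  have "integrable (measure_pmf (walk n)) (\<lambda>z. h (\<one> \<otimes> z))" using lip_harmonic_integrable[OF assms] by auto
  then show ?thesis
    by (rule integrable_cong_AE_imp) (auto simp: AE_measure_pmf_iff dest: walk_closed)
qed

lemma lip_harmonic_lincomb: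
  assumes h: "h \<in> lip_harmonic" and k: "k \<in> lip_harmonic"
  shows "(\<lambda>z. a * h z + b * k z) \<in> lip_harmonic"
proof -
  obtain L where L: "L \<ge> 0" "\<And>x y. x \<in> carrier G \<Longrightarrow> y \<in> carrier G \<Longrightarrow> \<bar>h (x \<otimes> y) - h x\<bar> \<le> L * len y"
    using lip_harmonic_lipschitz[OF h] by blast
  obtain M where M: "M \<ge> 0" "\<And>x y. x \<in> carrier G \<Longrightarrow> y \<in> carrier G \<Longrightarrow> \<bar>k (x \<otimes> y) - k x\<bar> \<le> M * len y"
    using lip_harmonic_lipschitz[OF k] by blast
  have "\<bar>a * h (x \<otimes> y) + b * k (x \<otimes> y) - (a * h x + b * k x)\<bar> \<le> (\<bar>a\<bar> * L + \<bar>b\<bar> * M) * len y"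
    if "x \<in> carrier G" "y \<in> carrier G" for x y
  proof -
    have "a * h (x \<otimes> y) + b * k (x \<otimes> y) - (a * h x + b * k x) = a * (h (x \<otimes> y) - h x) + b * (k (x \<otimes> y) - k x)"
      by (simp add: algebra_simps)
    also have "\<bar>\<dots>\<bar> \<le> \<bar>a\<bar> * \<bar>h (x \<otimes> y) - h x\<bar> + \<bar>b\<bar> * \<bar>k (x \<otimes> y) - k x\<bar>"
      using abs_triangle_ineq by (simp flip: abs_mult)
    also have "\<dots> \<le> \<bar>a\<bar> * (L * len y) + \<bar>b\<bar> * (M * len y)"
      using L(2)[OF that] M(2)[OF that] by (intro add_mono mult_left_mono) auto
    finally show ?thesis by (simp add: algebra_simps)
  qed
  moreover have "(\<integral>g. a * h (x \<otimes> g) + b * k (x \<otimes> g) \<partial>\<mu>) = a * h x + b * k x" if "x \<in> carrier G" for x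
    using lip_harmonic_integrable[OF h that] lip_harmonic_integrable[OF k that]
      lip_harmonic_mean[OF h that] lip_harmonic_mean[OF k that] by simp
  ultimately show ?thesis
    using lip_harmonic_outside[OF h] lip_harmonic_outside[OF k] lip_harmonic_one[OF h] lip_harmonic_one[OF k]
    by (intro lip_harmonicI[of _ "\<bar>a\<bar> * L + \<bar>b\<bar> * M"]) simp_all
qed

lemma lip_harmonic_zero: "(\<lambda>_. 0) \<in> lip_harmonic"
  by (rule lip_harmonicI[of _ 0]) auto

lemma lip_harmonic_sum:
  assumes "finite I" "\<And>i. i \<in> I \<Longrightarrow> h i \<in> lip_harmonic"
  shows "(\<lambda>z. \<Sum>i\<in>I. c i * h i z) \<in> lip_harmonic"
  using assms
proof (induction I rule: finite_induct)
  case (insert i I)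
  then show ?case using lip_harmonic_lincomb[of "h i" "\<lambda>z. \<Sum>i\<in>I. c i * h i z" "c i" 1] by simp
qed (simp add: lip_harmonic_zero)

lemma translate_one: "h \<in> lip_harmonic \<Longrightarrow> translate \<one> h = h"
  by (auto simp: translate_def lip_harmonic_one lip_harmonic_outside)

lemma translate_mult:
  "x \<in> carrier G \<Longrightarrow> y \<in> carrier G \<Longrightarrow> translate (x \<otimes> y) h = translate y (translate x h)"
  by (auto simp: translate_def m_assoc)

lemma translate_apply: "y \<in> carrier G \<Longrightarrow> translate x h y = h (x \<otimes> y) - h x"
  by (simp add: translate_def)

text \<open>Harmonicity and the Lipschitz bound concern right multiplication, so left translation
  preserves both, the latter with the same constant.\<close>

lemma lip_harmonic_translate:
  assumes h: "h \<in> lip_harmonic" and x: "x \<in> carrier G"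
  shows "translate x h \<in> lip_harmonic"
proof -
  obtain L where L: "L \<ge> 0" "\<And>x y. x \<in> carrier G \<Longrightarrow> y \<in> carrier G \<Longrightarrow> \<bar>h (x \<otimes> y) - h x\<bar> \<le> L * len y"
    using lip_harmonic_lipschitz[OF h] by blast
  have "(\<integral>g. translate x h (k \<otimes> g) \<partial>\<mu>) = translate x h k" if k: "k \<in> carrier G" for k
  proof -
    have "(\<integral>g. translate x h (k \<otimes> g) \<partial>\<mu>) = (\<integral>g. h ((x \<otimes> k) \<otimes> g) - h x \<partial>\<mu>)"
      using x k by (intro integral_cong_AE) (auto simp: AE_measure_pmf_iff translate_def m_assoc dest: step_closed)
    also have "\<dots> = h (x \<otimes> k) - h x"
      using lip_harmonic_integrable[OF h, of "x \<otimes> k"] lip_harmonic_mean[OF h, of "x \<otimes> k"] x k by simp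
    finally show ?thesis using k by (simp add: translate_def)
  qed
  moreover have "\<bar>translate x h (y \<otimes> z) - translate x h y\<bar> \<le> L * len z" if "y \<in> carrier G" "z \<in> carrier G" for y z
    using L(2)[of "x \<otimes> y" z] that x by (simp add: translate_def m_assoc)
  ultimately show ?thesis using x by (intro lip_harmonicI[of _ L]) (auto simp: translate_def)
qed

section \<open>Martingale means and second moments along the walk\<close>

lemma walk_mean:
  assumes h: "h \<in> lip_harmonic" and x: "x \<in> carrier G"
  shows "(\<integral>z. h (x \<otimes> z) \<partial>walk n) = h x"
  using x
proof (induction n arbitrary: x)
  case (Suc n)
  obtain A B where "\<And>z. z \<in> carrier G \<Longrightarrow> \<bar>h (x \<otimes> z)\<bar> \<le> A + B * (len z)\<^sup>2"
    using lip_harmonic_translated_bound[OF h \<open>x \<in> carrier G\<close>] by blast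
  then have "(\<integral>z. h (x \<otimes> z) \<partial>walk (Suc n)) = (\<integral>g. \<integral>z. h (x \<otimes> (g \<otimes> z)) \<partial>walk n \<partial>\<mu>)"
    by (rule walk_Suc_expectation)
  also have "\<dots> = (\<integral>g. h (x \<otimes> g) \<partial>\<mu>)"
  proof (intro integral_cong_AE AE_pmfI)
    fix g assume "g \<in> set_pmf \<mu>"
    then have g: "g \<in> carrier G" by (rule step_closed)
    have "(\<integral>z. h (x \<otimes> (g \<otimes> z)) \<partial>walk n) = (\<integral>z. h ((x \<otimes> g) \<otimes> z) \<partial>walk n)"
      using g Suc.prems by (intro integral_cong_AE AE_pmfI) (auto simp: m_assoc dest: walk_closed)
    then show "(\<integral>z. h (x \<otimes> (g \<otimes> z)) \<partial>walk n) = h (x \<otimes> g)" using Suc.IH[of "x \<otimes> g"] g Suc.prems by simp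
  qed auto
  finally show ?case using lip_harmonic_mean[OF h Suc.prems] by simp
qed simp

lemma walk_mean_zero:
  assumes h: "h \<in> lip_harmonic"
  shows "(\<integral>z. h z \<partial>walk n) = 0"
proof -
  have "(\<integral>z. h z \<partial>walk n) = (\<integral>z. h (\<one> \<otimes> z) \<partial>walk n)"
    by (intro integral_cong_AE AE_pmfI) (auto dest: walk_closed)
  then show ?thesis using walk_mean[OF h one_closed] lip_harmonic_one[OF h] by simp
qed

text \<open>Pythagoras: the cross term vanishes because the translate has mean zero along the
  walk.\<close>

lemma walk_second_moment_translate:
  assumes h: "h \<in> lip_harmonic" and x: "x \<in> carrier G"
  shows "(\<integral>z. (h (x \<otimes> z))\<^sup>2 \<partial>walk n) = (h x)\<^sup>2 + (\<integral>z. (translate x h z)\<^sup>2 \<partial>walk n)"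
proof -
  note T = lip_harmonic_translate[OF h x]
  have "(\<integral>z. (h (x \<otimes> z))\<^sup>2 \<partial>walk n) = (\<integral>z. (h x)\<^sup>2 + 2 * h x * translate x h z + (translate x h z)\<^sup>2 \<partial>walk n)"
    by (intro integral_cong_AE AE_pmfI)
      (auto simp: translate_def power2_eq_square algebra_simps dest!: walk_closed)
  also have "\<dots> = (h x)\<^sup>2 + 2 * h x * (\<integral>z. translate x h z \<partial>walk n) + (\<integral>z. (translate x h z)\<^sup>2 \<partial>walk n)"
    using lip_harmonic_integrable'[OF T] lip_harmonic_square_integrable[OF T] by simp
  finally show ?thesis using walk_mean_zero[OF T] by simp
qed

lemma square_bound:
  assumes "h \<in> lip_harmonic"
  obtains B where "\<And>z. z \<in> carrier G \<Longrightarrow> \<bar>(h z)\<^sup>2\<bar> \<le> 0 + B * (len z)\<^sup>2"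
  using lip_harmonic_product_bound[OF assms assms] that by (metis power2_eq_square)

text \<open>Conditioning on the first step \<open>g\<close>: it contributes the energy, and the
  remaining walk sees the translate by \<open>g\<close>.\<close>

lemma second_moment_recursion:
  assumes h: "h \<in> lip_harmonic"
  shows "(\<integral>z. (h z)\<^sup>2 \<partial>walk (Suc n)) = energy h + (\<integral>g. \<integral>z. (translate g h z)\<^sup>2 \<partial>walk n \<partial>\<mu>)"
    and "integrable (measure_pmf \<mu>) (\<lambda>g. \<integral>z. (translate g h z)\<^sup>2 \<partial>walk n)"
proof -
  obtain B where B: "\<And>z. z \<in> carrier G \<Longrightarrow> \<bar>(h z)\<^sup>2\<bar> \<le> 0 + B * (len z)\<^sup>2"
    using square_bound[OF h] by blast
  have R: "(\<integral>z. (h z)\<^sup>2 \<partial>walk (Suc n)) = (\<integral>g. \<integral>z. (h (g \<otimes> z))\<^sup>2 \<partial>walk n \<partial>\<mu>)"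
    "integrable (measure_pmf \<mu>) (\<lambda>g. \<integral>z. (h (g \<otimes> z))\<^sup>2 \<partial>walk n)"
    by (rule walk_Suc_expectation[OF B]; assumption)+
  have eq: "AE g in \<mu>. (\<integral>z. (h (g \<otimes> z))\<^sup>2 \<partial>walk n) = (h g)\<^sup>2 + (\<integral>z. (translate g h z)\<^sup>2 \<partial>walk n)"
    by (intro AE_pmfI walk_second_moment_translate[OF h] step_closed)
  have "integrable (measure_pmf \<mu>) (\<lambda>g. (\<integral>z. (h (g \<otimes> z))\<^sup>2 \<partial>walk n) - (h g)\<^sup>2)"
    using R(2) lip_harmonic_square_integrable[OF h] by auto
  then show int: "integrable (measure_pmf \<mu>) (\<lambda>g. \<integral>z. (translate g h z)\<^sup>2 \<partial>walk n)"
    by (rule integrable_cong_AE_imp) (use eq in auto)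
  have "(\<integral>z. (h z)\<^sup>2 \<partial>walk (Suc n)) = (\<integral>g. (h g)\<^sup>2 + (\<integral>z. (translate g h z)\<^sup>2 \<partial>walk n) \<partial>\<mu>)"
    unfolding R(1) using eq by (intro integral_cong_AE) auto
  then show "(\<integral>z. (h z)\<^sup>2 \<partial>walk (Suc n)) = energy h + (\<integral>g. \<integral>z. (translate g h z)\<^sup>2 \<partial>walk n \<partial>\<mu>)"
    using int lip_harmonic_square_integrable[OF h] by (simp add: energy_def)
qed

lemma second_moment_recursion_translate:
  assumes h: "h \<in> lip_harmonic" and x: "x \<in> carrier G"
  shows "(\<integral>z. (translate x h z)\<^sup>2 \<partial>walk (Suc n))
      = energy (translate x h) + (\<integral>g. \<integral>z. (translate (x \<otimes> g) h z)\<^sup>2 \<partial>walk n \<partial>\<mu>)"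
    and "integrable (measure_pmf \<mu>) (\<lambda>g. \<integral>z. (translate (x \<otimes> g) h z)\<^sup>2 \<partial>walk n)"
proof -
  note T = lip_harmonic_translate[OF h x]
  have eq: "AE g in \<mu>. (\<integral>z. (translate g (translate x h) z)\<^sup>2 \<partial>walk n) = (\<integral>z. (translate (x \<otimes> g) h z)\<^sup>2 \<partial>walk n)"
    by (intro AE_pmfI) (simp add: translate_mult[OF x step_closed])
  show "integrable (measure_pmf \<mu>) (\<lambda>g. \<integral>z. (translate (x \<otimes> g) h z)\<^sup>2 \<partial>walk n)"
    by (rule integrable_cong_AE_imp[OF second_moment_recursion(2)[OF T]]) (use eq in auto)
  have "(\<integral>g. \<integral>z. (translate g (translate x h) z)\<^sup>2 \<partial>walk n \<partial>\<mu>) = (\<integral>g. \<integral>z. (translate (x \<otimes> g) h z)\<^sup>2 \<partial>walk n \<partial>\<mu>)"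
    using eq by (intro integral_cong_AE) auto
  then show "(\<integral>z. (translate x h z)\<^sup>2 \<partial>walk (Suc n))
      = energy (translate x h) + (\<integral>g. \<integral>z. (translate (x \<otimes> g) h z)\<^sup>2 \<partial>walk n \<partial>\<mu>)"
    using second_moment_recursion(1)[OF T] by simp
qed

text \<open>Each step adds the summed energy at the point reached, averaged. A single
  \<open>C\<close> for the whole sum, instead of one per function, is what later limits the size of
  an orthonormal family.\<close>

lemma second_moment_family_bound:
  assumes "finite I" and h: "\<And>i. i \<in> I \<Longrightarrow> h i \<in> lip_harmonic"
    and C: "\<And>x. x \<in> carrier G \<Longrightarrow> (\<Sum>i\<in>I. energy (translate x (h i))) \<le> C"
    and x: "x \<in> carrier G"
  shows "(\<Sum>i\<in>I. \<integral>z. (translate x (h i) z)\<^sup>2 \<partial>walk n) \<le> real n * C"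
  using x
proof (induction n arbitrary: x)
  case 0
  then show ?case using h by (simp add: translate_def)
next
  case (Suc n)
  note R = second_moment_recursion_translate[OF h \<open>x \<in> carrier G\<close>]
  have "(\<Sum>i\<in>I. \<integral>z. (translate x (h i) z)\<^sup>2 \<partial>walk (Suc n))
      = (\<Sum>i\<in>I. energy (translate x (h i))) + (\<integral>g. (\<Sum>i\<in>I. \<integral>z. (translate (x \<otimes> g) (h i) z)\<^sup>2 \<partial>walk n) \<partial>\<mu>)"
    using R by (simp add: sum.distrib del: walk.simps)
  also have "\<dots> \<le> C + (\<integral>g. real n * C \<partial>\<mu>)"
  proof (intro add_mono C integral_mono_AE AE_pmfI)
    show "(\<Sum>i\<in>I. \<integral>z. (translate (x \<otimes> g) (h i) z)\<^sup>2 \<partial>walk n) \<le> real n * C" if "g \<in> set_pmf \<mu>" for g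
      using Suc.IH[of "x \<otimes> g"] Suc.prems step_closed[OF that] by simp
  qed (use R Suc.prems in auto)
  finally show ?case by (simp add: algebra_simps)
qed

text \<open>All translates share the Lipschitz constant L, so L^2 times the second moment of a step
  bounds every energy.\<close>

lemma energy_translate_bound:
  assumes h: "h \<in> lip_harmonic"
  obtains C where "C \<ge> 0" "\<And>x. x \<in> carrier G \<Longrightarrow> energy (translate x h) \<le> C"
proof -
  obtain L where L: "L \<ge> 0" "\<And>x y. x \<in> carrier G \<Longrightarrow> y \<in> carrier G \<Longrightarrow> \<bar>h (x \<otimes> y) - h x\<bar> \<le> L * len y"
    using lip_harmonic_lipschitz[OF h] by blast
  have "energy (translate x h) \<le> (\<integral>g. L\<^sup>2 * (len g)\<^sup>2 \<partial>\<mu>)" if x: "x \<in> carrier G" for x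
    unfolding energy_def
  proof (intro integral_mono_AE AE_pmfI)
    fix g assume "g \<in> set_pmf \<mu>"
    then have "\<bar>translate x h g\<bar> \<le> L * len g" using L(2)[OF x step_closed] by (simp add: translate_def step_closed)
    then have "\<bar>translate x h g\<bar>\<^sup>2 \<le> (L * len g)\<^sup>2" by (intro power_mono) auto
    then show "(translate x h g)\<^sup>2 \<le> L\<^sup>2 * (len g)\<^sup>2" by (simp add: power_mult_distrib)
  qed (use step_second_moment lip_harmonic_square_integrable lip_harmonic_translate[OF h x] in auto)
  moreover have "0 \<le> (\<integral>g. L\<^sup>2 * (len g)\<^sup>2 \<partial>\<mu>)" by simp
  ultimately show ?thesis using that by blast
qed

lemma energy_nonneg: "0 \<le> energy h"
  by (simp add: energy_def)

text \<open>By the recursion, each time increment is the average of the preceding one over a step,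
  and the first is an energy, which lies between 0 and \<open>C\<close>.\<close>

lemma second_moment_increment:
  assumes h: "h \<in> lip_harmonic" and C: "\<And>x. x \<in> carrier G \<Longrightarrow> energy (translate x h) \<le> C" and x: "x \<in> carrier G"
  shows "\<bar>(\<integral>z. (translate x h z)\<^sup>2 \<partial>walk (Suc n)) - (\<integral>z. (translate x h z)\<^sup>2 \<partial>walk n)\<bar> \<le> C"
    and "(\<integral>z. (translate x h z)\<^sup>2 \<partial>walk n) \<le> (\<integral>z. (translate x h z)\<^sup>2 \<partial>walk (Suc n))"
proof -
  define w where "w n y = (\<integral>z. (translate y h z)\<^sup>2 \<partial>walk n)" for n y
  have rec: "w (Suc n) y = energy (translate y h) + (\<integral>g. w n (y \<otimes> g) \<partial>\<mu>)"
    and int: "integrable (measure_pmf \<mu>) (\<lambda>g. w n (y \<otimes> g))" if "y \<in> carrier G" for n y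
    unfolding w_def by (fact second_moment_recursion_translate[OF h that])+
  have w0: "w 0 y = 0" if "y \<in> carrier G" for y
    using that by (simp add: w_def translate_def)
  have "0 \<le> w (Suc n) y - w n y \<and> w (Suc n) y - w n y \<le> C" if "y \<in> carrier G" for n y
    using that
  proof (induction n arbitrary: y)
    case 0
    have "(\<integral>g. w 0 (y \<otimes> g) \<partial>\<mu>) = 0"
      by (intro integral_eq_zero_AE AE_pmfI w0 m_closed 0 step_closed)
    then show ?case
      using rec[OF 0, of 0] w0[OF 0] energy_nonneg[of "translate y h"] C[OF 0] by linarith
  next
    case (Suc n)
    have "w (Suc (Suc n)) y - w (Suc n) y = (\<integral>g. w (Suc n) (y \<otimes> g) - w n (y \<otimes> g) \<partial>\<mu>)"
      unfolding rec[OF Suc.prems] using int[OF Suc.prems] by simp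
    moreover have IH: "0 \<le> w (Suc n) (y \<otimes> g) - w n (y \<otimes> g)" "w (Suc n) (y \<otimes> g) - w n (y \<otimes> g) \<le> C"
      if "g \<in> set_pmf \<mu>" for g
      using Suc.IH[OF m_closed[OF Suc.prems step_closed[OF that]]] by blast+
    moreover have "0 \<le> (\<integral>g. w (Suc n) (y \<otimes> g) - w n (y \<otimes> g) \<partial>\<mu>)"
      by (intro integral_nonneg_AE AE_pmfI IH)
    moreover have "(\<integral>g. w (Suc n) (y \<otimes> g) - w n (y \<otimes> g) \<partial>\<mu>) \<le> (\<integral>g. C \<partial>\<mu>)"
      by (intro integral_mono_AE AE_pmfI IH Bochner_Integration.integrable_diff int[OF Suc.prems]) auto
    ultimately show ?case by simp
  qed
  from this[OF x, of n]
  show "\<bar>(\<integral>z. (translate x h z)\<^sup>2 \<partial>walk (Suc n)) - (\<integral>z. (translate x h z)\<^sup>2 \<partial>walk n)\<bar> \<le> C"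
    and "(\<integral>z. (translate x h z)\<^sup>2 \<partial>walk n) \<le> (\<integral>z. (translate x h z)\<^sup>2 \<partial>walk (Suc n))"
    unfolding w_def by linarith+
qed

lemma second_moment_bound:
  assumes h: "h \<in> lip_harmonic" and C: "\<And>x. x \<in> carrier G \<Longrightarrow> energy (translate x h) \<le> C" and x: "x \<in> carrier G"
  shows "(\<integral>z. (translate x h z)\<^sup>2 \<partial>walk n) \<le> real n * C"
  using second_moment_family_bound[of "{()}" "\<lambda>_. h" C x n] assms by simp

text \<open>Averaging \<open>w\<close> over one step changes it by a time increment minus an energy,
  both between 0 and \<open>C\<close>. Thus \<open>m\<close> steps cost at most
  \<open>m * C\<close>, whatever \<open>n\<close> is.\<close>

lemma second_moment_almost_harmonic:
  fixes m n :: nat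
  assumes h: "h \<in> lip_harmonic" and C: "\<And>x. x \<in> carrier G \<Longrightarrow> energy (translate x h) \<le> C" and x: "x \<in> carrier G"
  defines "w \<equiv> \<lambda>y. \<integral>z. (translate y h z)\<^sup>2 \<partial>walk n"
  shows "\<bar>(\<integral>z. w (x \<otimes> z) \<partial>walk m) - w x\<bar> \<le> real m * C"
  using x
proof (induction m arbitrary: x)
  case 0
  then show ?case by simp
next
  case (Suc m)
  have wb: "\<bar>w y\<bar> \<le> real n * C" if "y \<in> carrier G" for y
    using second_moment_bound[OF h C that, of n] by (simp add: w_def)
  have bnd: "\<And>z. z \<in> carrier G \<Longrightarrow> \<bar>w (x \<otimes> z)\<bar> \<le> real n * C + 0 * (len z)\<^sup>2"
    using wb Suc.prems by simp
  have R: "(\<integral>z. w (x \<otimes> z) \<partial>walk (Suc m)) = (\<integral>g. \<integral>z. w (x \<otimes> (g \<otimes> z)) \<partial>walk m \<partial>\<mu>)"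
    "integrable (measure_pmf \<mu>) (\<lambda>g. \<integral>z. w (x \<otimes> (g \<otimes> z)) \<partial>walk m)"
    using walk_Suc_expectation[OF bnd] by auto
  have int: "integrable (measure_pmf \<mu>) (\<lambda>g. w (x \<otimes> g))"
    using second_moment_recursion_translate(2)[OF h Suc.prems] by (simp add: w_def)
  have "\<bar>(\<integral>g. \<integral>z. w (x \<otimes> (g \<otimes> z)) \<partial>walk m \<partial>\<mu>) - (\<integral>g. w (x \<otimes> g) \<partial>\<mu>)\<bar>
      = \<bar>\<integral>g. (\<integral>z. w (x \<otimes> (g \<otimes> z)) \<partial>walk m) - w (x \<otimes> g) \<partial>\<mu>\<bar>"
    using R(2) int by simp
  also have "\<dots> \<le> (\<integral>g. \<bar>(\<integral>z. w (x \<otimes> (g \<otimes> z)) \<partial>walk m) - w (x \<otimes> g)\<bar> \<partial>\<mu>)"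
    by (rule integral_abs_bound)
  also have "\<dots> \<le> (\<integral>g. real m * C \<partial>\<mu>)"
  proof (intro integral_mono_AE AE_pmfI)
    fix g assume "g \<in> set_pmf \<mu>"
    then have g: "g \<in> carrier G" by (rule step_closed)
    have "(\<integral>z. w (x \<otimes> (g \<otimes> z)) \<partial>walk m) = (\<integral>z. w ((x \<otimes> g) \<otimes> z) \<partial>walk m)"
      using g Suc.prems by (intro integral_cong_AE AE_pmfI) (auto simp: m_assoc dest: walk_closed)
    then show "\<bar>(\<integral>z. w (x \<otimes> (g \<otimes> z)) \<partial>walk m) - w (x \<otimes> g)\<bar> \<le> real m * C"
      using Suc.IH[of "x \<otimes> g"] Suc.prems g by simp
  qed (use R(2) int in auto)
  finally have "\<bar>(\<integral>z. w (x \<otimes> z) \<partial>walk (Suc m)) - (\<integral>g. w (x \<otimes> g) \<partial>\<mu>)\<bar> \<le> real m * C"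
    using R(1) by simp
  moreover have "\<bar>(\<integral>g. w (x \<otimes> g) \<partial>\<mu>) - w x\<bar> \<le> C"
    using second_moment_recursion_translate(1)[OF h Suc.prems, of n] second_moment_increment[OF h C Suc.prems, of n]
      energy_nonneg[of "translate x h"] C[OF Suc.prems] unfolding w_def by linarith
  ultimately show ?case by (simp add: algebra_simps del: walk.simps)
qed

lemma step_expectation_diff:
  fixes h :: "'a \<Rightarrow> real"
  assumes g: "g \<in> carrier G" and int: "integrable (measure_pmf (walk n)) (\<lambda>z. h (g \<otimes> z))" "integrable (measure_pmf (walk (Suc n))) h"
    "integrable (measure_pmf (walk n)) (\<lambda>z. (h (g \<otimes> z))\<^sup>2)" "integrable (measure_pmf (walk (Suc n))) (\<lambda>z. (h z)\<^sup>2)"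
  shows "((\<integral>z. h (g \<otimes> z) \<partial>walk n) - (\<integral>z. h z \<partial>walk (Suc n)))\<^sup>2
     \<le> 2 * step_hellinger n g * ((\<integral>z. (h (g \<otimes> z))\<^sup>2 \<partial>walk n) + (\<integral>z. (h z)\<^sup>2 \<partial>walk (Suc n)))"
proof -
  have im: "integrable (measure_pmf (map_pmf (\<lambda>z. g \<otimes> z) (walk n))) f"
    if "integrable (measure_pmf (walk n)) (\<lambda>z. f (g \<otimes> z))" for f :: "'a \<Rightarrow> real"
    using that by simp
  have nonneg: "0 \<le> (\<integral>z. (h (g \<otimes> z))\<^sup>2 \<partial>walk n) + (\<integral>z. (h z)\<^sup>2 \<partial>walk (Suc n))"
    by (intro add_nonneg_nonneg integral_nonneg_AE) auto
  have "ennreal (((\<integral>z. h z \<partial>map_pmf (\<lambda>z. g \<otimes> z) (walk n)) - (\<integral>z. h z \<partial>walk (Suc n)))\<^sup>2)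
     \<le> 2 * ennreal (step_hellinger n g) * ennreal ((\<integral>z. (h z)\<^sup>2 \<partial>map_pmf (\<lambda>z. g \<otimes> z) (walk n)) + (\<integral>z. (h z)\<^sup>2 \<partial>walk (Suc n)))"
    unfolding ennreal_step_hellinger
    by (rule hellinger_square_expectation_diff) (use int in \<open>auto intro!: im simp del: walk.simps\<close>)
  also have "\<dots> = ennreal (2 * step_hellinger n g * ((\<integral>z. (h (g \<otimes> z))\<^sup>2 \<partial>walk n) + (\<integral>z. (h z)\<^sup>2 \<partial>walk (Suc n))))"
    using nonneg step_hellinger_nonneg[of n g] by (simp add: ennreal_mult del: walk.simps)
  finally have "ennreal (((\<integral>z. h (g \<otimes> z) \<partial>walk n) - (\<integral>z. h z \<partial>walk (Suc n)))\<^sup>2) \<le> \<dots>"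
    by (simp del: walk.simps)
  then show ?thesis
    using nonneg step_hellinger_nonneg[of n g] by (subst (asm) ennreal_le_iff) auto
qed

text \<open>The second moment is almost harmonic as a function of the starting point and bounded by \<open>n C\<close>, so
  moving the starting point by \<open>g\<close> is absorbed by \<open>m\<close> further steps of the walk, up to the Hellinger
  distance of the laws after these steps.\<close>

lemma second_moment_almost_invariant:
  assumes h: "h \<in> lip_harmonic" and C: "\<And>x. x \<in> carrier G \<Longrightarrow> energy (translate x h) \<le> C" and g: "g \<in> set_pmf \<mu>"
  shows "\<bar>(\<integral>z. (translate g h z)\<^sup>2 \<partial>walk n) - (\<integral>z. (h z)\<^sup>2 \<partial>walk n)\<bar>
    \<le> (2 * real m + 1) * C + 2 * real n * C * sqrt (step_hellinger m g)"
proof -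
  define w where "w y = (\<integral>z. (translate y h z)\<^sup>2 \<partial>walk n)" for y
  have gG: "g \<in> carrier G" using g by (rule step_closed)
  have C0: "0 \<le> C" using C[OF one_closed] energy_nonneg[of "translate \<one> h"] by linarith
  have w0: "0 \<le> w y" for y by (simp add: w_def)
  have wb: "w y \<le> real n * C" if "y \<in> carrier G" for y
    using second_moment_bound[OF h C that, of n] by (simp add: w_def)
  have sq: "(w y)\<^sup>2 \<le> (real n * C)\<^sup>2" if "y \<in> carrier G" for y
    using wb[OF that] w0[of y] by (intro power_mono)
  have int: "integrable (measure_pmf (walk k)) (\<lambda>z. w z)" "integrable (measure_pmf (walk k)) (\<lambda>z. w (g \<otimes> z))"
    "integrable (measure_pmf (walk k)) (\<lambda>z. (w z)\<^sup>2)" "integrable (measure_pmf (walk k)) (\<lambda>z. (w (g \<otimes> z))\<^sup>2)" for k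
    by (rule walk_integrable[of _ "real n * C" 0] walk_integrable[of _ "(real n * C)\<^sup>2" 0]; use w0 wb sq gG in auto)+
  \<comment> \<open>The distance estimate is applied to \<open>w\<close> instead of
    \<open>h\<close>. Its values on the carrier lie between 0 and \<open>n * C\<close>, so the sum
    of the two second moments is at most 2 (n C)^2.\<close>
  have "((\<integral>z. w (g \<otimes> z) \<partial>walk m) - (\<integral>z. w z \<partial>walk (Suc m)))\<^sup>2
     \<le> 2 * step_hellinger m g * ((\<integral>z. (w (g \<otimes> z))\<^sup>2 \<partial>walk m) + (\<integral>z. (w z)\<^sup>2 \<partial>walk (Suc m)))"
    by (intro step_expectation_diff gG int)
  also have "\<dots> \<le> 2 * step_hellinger m g * ((\<integral>z. (real n * C)\<^sup>2 \<partial>walk m) + (\<integral>z. (real n * C)\<^sup>2 \<partial>walk (Suc m)))"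
    using step_hellinger_nonneg[of m g] gG
    by (intro mult_left_mono add_mono integral_mono_AE int AE_pmfI sq) (auto dest: walk_closed simp del: walk.simps)
  also have "\<dots> = (2 * real n * C * sqrt (step_hellinger m g))\<^sup>2"
    using step_hellinger_nonneg[of m g] by (simp add: power_mult_distrib algebra_simps del: walk.simps)
  finally have "\<bar>(\<integral>z. w (g \<otimes> z) \<partial>walk m) - (\<integral>z. w z \<partial>walk (Suc m))\<bar> \<le> 2 * real n * C * sqrt (step_hellinger m g)"
    using C0 step_hellinger_nonneg[of m g] by (subst (asm) abs_le_square_iff[symmetric]) (auto simp: abs_mult simp del: walk.simps)
  moreover have "\<bar>(\<integral>z. w (g \<otimes> z) \<partial>walk m) - w g\<bar> \<le> real m * C"
    using second_moment_almost_harmonic[OF h C gG, where n = n] by (simp add: w_def)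
  \<comment> \<open>The mixture is the law after one more step, hence \<open>Suc m\<close> here and
    2m + 1 in total.\<close>
  moreover have "\<bar>(\<integral>z. w z \<partial>walk (Suc m)) - w \<one>\<bar> \<le> real (Suc m) * C"
  proof -
    have "(\<integral>z. w z \<partial>walk (Suc m)) = (\<integral>z. w (\<one> \<otimes> z) \<partial>walk (Suc m))"
      by (intro integral_cong_AE AE_pmfI) (auto dest: walk_closed simp del: walk.simps)
    then show ?thesis
      using second_moment_almost_harmonic[OF h C one_closed, where n = n and m = "Suc m"] by (simp add: w_def del: walk.simps)
  qed
  moreover have "w \<one> = (\<integral>z. (h z)\<^sup>2 \<partial>walk n)" by (simp add: w_def translate_one[OF h])
  ultimately show ?thesis unfolding w_def[of g, symmetric]
    by (simp add: algebra_simps del: walk.simps)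
qed

end

section \<open>The limiting covariance form\<close>

text \<open>Turns bounds over finite sets of steps, such as \<open>d_sum\<close>, into a bound on a
  mean.\<close>

lemma pmf_expectation_le_finite_sums:
  fixes f :: "'a \<Rightarrow> real"
  assumes "integrable (measure_pmf p) f" "\<And>x. 0 \<le> f x"
    and "\<And>A. finite A \<Longrightarrow> A \<subseteq> set_pmf p \<Longrightarrow> (\<Sum>x\<in>A. pmf p x * f x) \<le> c"
  shows "(\<integral>x. f x \<partial>measure_pmf p) \<le> c"
proof -
  have "(\<lambda>x. pmf p x * f x) summable_on set_pmf p"
    using assms(1,2) pmf_integrable_iff_summable_on[of p "set_pmf p" f] by simp
  then show ?thesis
    using pmf_expectation_eq_infsum[of p "set_pmf p" f] assms by (simp add: infsum_le_finite_sums)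
qed

text \<open>The outcome of all limit choices: \<open>d g\<close> is the rescaled distance and
  \<open>B\<close> the rescaled covariance. Division by \<open>Suc n\<close> is harmless in the
  limit and makes sense at 0. \<open>d_sum\<close> is restricted to finite sets because finite sums
  pass to the limit along any filter.\<close>

locale walk_limit = growth_walk G S \<mu> for G :: "('a, 'b) monoid_scheme" (structure) and S \<mu> +
  fixes F :: "nat filter" and B :: "('a \<Rightarrow> real) \<Rightarrow> ('a \<Rightarrow> real) \<Rightarrow> real" and d :: "'a \<Rightarrow> real" and K :: real
  assumes F_nontrivial: "F \<noteq> bot" and F_le: "F \<le> sequentially"
    and B_limit: "h \<in> lip_harmonic \<Longrightarrow> k \<in> lip_harmonic \<Longrightarrow>
      ((\<lambda>n. (\<integral>z. h z * k z \<partial>walk n) / real (Suc n)) \<longlongrightarrow> B h k) F"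
    and d_limit: "g \<in> set_pmf \<mu> \<Longrightarrow> ((\<lambda>n. real (Suc n) * step_hellinger n g) \<longlongrightarrow> d g) F"
    and d_sum: "finite A \<Longrightarrow> A \<subseteq> set_pmf \<mu> \<Longrightarrow> (\<Sum>g\<in>A. pmf \<mu> g * d g) \<le> K"

section \<open>Existence of the limiting form\<close>

context growth_walk
begin

lemma second_moment_linear_bound:
  assumes h: "h \<in> lip_harmonic"
  obtains C where "C \<ge> 0" "\<And>n. (\<integral>z. (h z)\<^sup>2 \<partial>walk n) \<le> real n * C"
proof -
  obtain C where C: "C \<ge> 0" "\<And>x. x \<in> carrier G \<Longrightarrow> energy (translate x h) \<le> C"
    using energy_translate_bound[OF h] by blast
  show ?thesis using that[OF C(1)] second_moment_bound[OF h C(2) one_closed] by (simp add: translate_one[OF h])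
qed

lemma correlation_bound:
  assumes h: "h \<in> lip_harmonic" and k: "k \<in> lip_harmonic"
  shows "\<exists>b. \<forall>n. \<bar>(\<integral>z. h z * k z \<partial>walk n) / real (Suc n)\<bar> \<le> b"
proof -
  obtain C where C: "C \<ge> 0" "\<And>n. (\<integral>z. (h z)\<^sup>2 \<partial>walk n) \<le> real n * C"
    using second_moment_linear_bound[OF h] by blast
  obtain D where D: "D \<ge> 0" "\<And>n. (\<integral>z. (k z)\<^sup>2 \<partial>walk n) \<le> real n * D"
    using second_moment_linear_bound[OF k] by blast
  have "\<bar>(\<integral>z. h z * k z \<partial>walk n) / real (Suc n)\<bar> \<le> C + D" for n
  proof -
    have "\<bar>\<integral>z. h z * k z \<partial>walk n\<bar> \<le> (\<integral>z. \<bar>h z * k z\<bar> \<partial>walk n)" by (rule integral_abs_bound)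
    also have "\<dots> \<le> (\<integral>z. (h z)\<^sup>2 + (k z)\<^sup>2 \<partial>walk n)"
    proof (intro integral_mono)
      fix z
      have "2 * (\<bar>h z\<bar> * \<bar>k z\<bar>) \<le> (h z)\<^sup>2 + (k z)\<^sup>2" using sum_squares_bound[of "\<bar>h z\<bar>" "\<bar>k z\<bar>"] by simp
      moreover have "0 \<le> \<bar>h z\<bar> * \<bar>k z\<bar>" by simp
      ultimately show "\<bar>h z * k z\<bar> \<le> (h z)\<^sup>2 + (k z)\<^sup>2" unfolding abs_mult by linarith
    qed (use lip_harmonic_product_integrable[OF h k] lip_harmonic_square_integrable[OF h] lip_harmonic_square_integrable[OF k] in auto)
    also have "\<dots> \<le> real n * C + real n * D"
      using lip_harmonic_square_integrable[OF h] lip_harmonic_square_integrable[OF k] C(2)[of n] D(2)[of n] by simp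
    also have "\<dots> \<le> real (Suc n) * (C + D)" using C(1) D(1) by (simp add: algebra_simps)
    finally have "\<bar>\<integral>z. h z * k z \<partial>walk n\<bar> / real (Suc n) \<le> real (Suc n) * (C + D) / real (Suc n)"
      by (rule divide_right_mono) simp
    then show ?thesis by (simp add: abs_divide)
  qed
  then show ?thesis by blast
qed

text \<open>Compactness is used twice along the times of small entropy increment: for the
  covariances of all pairs of functions, then for the rescaled distances of all steps.\<close>

lemma walk_limit_exists: "\<exists>F B d K. walk_limit G S \<mu> F B d K"
proof -
  obtain K where K: "K > 0"
    "\<exists>\<^sub>\<infinity>n. \<forall>A. finite A \<longrightarrow> (\<Sum>g\<in>A. pmf \<mu> g * step_hellinger n g) \<le> K / real (Suc n)"
    using step_hellinger_decay by blast
  define N where "N = {n. \<forall>A. finite A \<longrightarrow> (\<Sum>g\<in>A. pmf \<mu> g * step_hellinger n g) \<le> K / real (Suc n)}"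
  define F0 where "F0 = inf sequentially (principal N)"
  have F0: "F0 \<noteq> bot"
  proof
    assume "F0 = bot"
    then have "eventually (\<lambda>_. False) F0" by simp
    then have "eventually (\<lambda>n. n \<notin> N) sequentially" unfolding F0_def eventually_inf_principal by simp
    then show False using K(2) by (simp add: frequently_def cofinite_eq_sequentially N_def)
  qed
  \<comment> \<open>The default 0 gives a bounded sequence to every pair of functions, so that all
    pairs can serve as one index set.\<close>
  define q where "q p n = (if fst p \<in> lip_harmonic \<and> snd p \<in> lip_harmonic
       then (\<integral>z. fst p z * snd p z \<partial>walk n) / real (Suc n) else 0)" for p n
  have "\<exists>b. \<forall>\<^sub>F n in F0. \<bar>q p n\<bar> \<le> b" for p
  proof (cases "fst p \<in> lip_harmonic \<and> snd p \<in> lip_harmonic")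
    case True
    then obtain b where "\<forall>n. \<bar>(\<integral>z. fst p z * snd p z \<partial>walk n) / real (Suc n)\<bar> \<le> b"
      using correlation_bound by blast
    then show ?thesis using True by (intro exI[of _ b] always_eventually) (simp add: q_def)
  qed (auto simp: q_def intro!: exI[of _ 0])
  then obtain bq where "\<And>p. \<forall>\<^sub>F n in F0. \<bar>q p n\<bar> \<le> bq p" by metis
  then obtain F1 where F1: "F1 \<noteq> bot" "F1 \<le> F0" "\<And>p. \<exists>l. (q p \<longlongrightarrow> l) F1"
    using filter_limits_exist[OF F0] by metis
  define r where "r g n = (if g \<in> set_pmf \<mu> then real (Suc n) * step_hellinger n g else 0)" for g n
  have eN: "eventually (\<lambda>n. n \<in> N) F1"
    by (rule filter_leD[OF F1(2)]) (simp add: F0_def eventually_inf_principal)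
  \<comment> \<open>A single nonnegative term is at most the whole sum. The bound is not uniform in
    \<open>g\<close>, but compactness needs only one per index; off the support both sides are
    0.\<close>
  have bound: "\<forall>\<^sub>F n in F1. \<bar>r g n\<bar> \<le> K / pmf \<mu> g" for g
    using eN
  proof eventually_elim
    case (elim n)
    have "pmf \<mu> g * step_hellinger n g \<le> K / real (Suc n)" using elim unfolding N_def by (auto dest: spec[of _ "{g}"])
    then show ?case using K(1) step_hellinger_nonneg[of n g]
      by (auto simp: r_def field_simps pmf_positive_iff set_pmf_iff)
  qed
  obtain F where F: "F \<noteq> bot" "F \<le> F1" "\<And>g. \<exists>l. (r g \<longlongrightarrow> l) F"
    using filter_limits_exist[OF F1(1) bound] by metis
  obtain Bq where Bq: "\<And>p. (q p \<longlongrightarrow> Bq p) F"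
    using F1(3) tendsto_mono[OF F(2)] by metis
  obtain d where d: "\<And>g. (r g \<longlongrightarrow> d g) F" using F(3) by metis
  have "walk_limit G S \<mu> F (\<lambda>h k. Bq (h, k)) d K"
  proof unfold_locales
    show "F \<noteq> bot" by fact
    show "F \<le> sequentially" using order.trans[OF F(2) F1(2)] by (simp add: F0_def)
    show "((\<lambda>n. (\<integral>z. h z * k z \<partial>walk n) / real (Suc n)) \<longlongrightarrow> Bq (h, k)) F"
      if "h \<in> lip_harmonic" "k \<in> lip_harmonic" for h k
      using Bq[of "(h, k)"] that by (simp add: q_def[abs_def])
    show "((\<lambda>n. real (Suc n) * step_hellinger n g) \<longlongrightarrow> d g) F" if "g \<in> set_pmf \<mu>" for g
      using d[of g] that by (simp add: r_def[abs_def])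
    show "(\<Sum>g\<in>A. pmf \<mu> g * d g) \<le> K" if A: "finite A" "A \<subseteq> set_pmf \<mu>" for A
    proof (rule tendsto_upperbound[OF _ _ F(1)])
      show "((\<lambda>n. \<Sum>g\<in>A. pmf \<mu> g * r g n) \<longlongrightarrow> (\<Sum>g\<in>A. pmf \<mu> g * d g)) F"
        by (intro tendsto_sum tendsto_mult tendsto_const d)
      show "\<forall>\<^sub>F n in F. (\<Sum>g\<in>A. pmf \<mu> g * r g n) \<le> K"
        using filter_leD[OF F(2) eN]
      proof eventually_elim
        case (elim n)
        have "(\<Sum>g\<in>A. pmf \<mu> g * r g n) = real (Suc n) * (\<Sum>g\<in>A. pmf \<mu> g * step_hellinger n g)"
          unfolding sum_distrib_left using A(2) by (intro sum.cong) (auto simp: r_def)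
        also have "\<dots> \<le> real (Suc n) * (K / real (Suc n))"
          using elim A(1) unfolding N_def by (intro mult_left_mono) auto
        finally show ?case by simp
      qed
    qed
  qed
  then show ?thesis by blast
qed

end

section \<open>Invariance, definiteness and finite rank of the form\<close>

context walk_limit
begin

lemma inverse_Suc_tendsto: "((\<lambda>n. c / real (Suc n)) \<longlongrightarrow> 0) F"
proof -
  have "((\<lambda>n. c / real (Suc n)) \<longlongrightarrow> 0) sequentially" by real_asymp
  then show ?thesis using F_le tendsto_mono by blast
qed

lemma B_sym: "h \<in> lip_harmonic \<Longrightarrow> k \<in> lip_harmonic \<Longrightarrow> B h k = B k h"
  using B_limit[of h k] B_limit[of k h] tendsto_unique[OF F_nontrivial] by (simp add: mult.commute)

lemma B_nonneg: "h \<in> lip_harmonic \<Longrightarrow> 0 \<le> B h h"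
  by (rule tendsto_lowerbound[OF B_limit _ F_nontrivial]) auto

lemma B_lincomb:
  assumes "h \<in> lip_harmonic" "k \<in> lip_harmonic" "l \<in> lip_harmonic"
  shows "B (\<lambda>z. a * h z + b * k z) l = a * B h l + b * B k l"
proof -
  have "(\<integral>z. (a * h z + b * k z) * l z \<partial>walk n) = a * (\<integral>z. h z * l z \<partial>walk n) + b * (\<integral>z. k z * l z \<partial>walk n)" for n
  proof -
    have "(\<integral>z. (a * h z + b * k z) * l z \<partial>walk n) = (\<integral>z. a * (h z * l z) + b * (k z * l z) \<partial>walk n)"
      by (simp add: algebra_simps)
    then show ?thesis
      using lip_harmonic_product_integrable[OF assms(1,3)] lip_harmonic_product_integrable[OF assms(2,3)] by simp
  qed
  then have "((\<lambda>n. (\<integral>z. (a * h z + b * k z) * l z \<partial>walk n) / real (Suc n)) \<longlongrightarrow> a * B h l + b * B k l) F"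
    using tendsto_add[OF tendsto_mult[OF tendsto_const[of a] B_limit[OF assms(1,3)]] tendsto_mult[OF tendsto_const[of b] B_limit[OF assms(2,3)]]]
    by (simp add: add_divide_distrib)
  then show ?thesis
    using tendsto_unique[OF F_nontrivial B_limit[OF lip_harmonic_lincomb[OF assms(1,2), of a b] assms(3)]] by blast
qed

lemma B_sum:
  assumes "finite I" "\<And>i. i \<in> I \<Longrightarrow> h i \<in> lip_harmonic" "l \<in> lip_harmonic"
  shows "B (\<lambda>z. \<Sum>i\<in>I. c i * h i z) l = (\<Sum>i\<in>I. c i * B (h i) l)"
  using assms(1,2)
proof (induction I rule: finite_induct)
  case empty
  then show ?case using B_lincomb[OF assms(3) assms(3) assms(3), of 0 0] by simp
next
  case (insert i I)
  then show ?case
    using B_lincomb[of "h i" "\<lambda>z. \<Sum>i\<in>I. c i * h i z" l "c i" 1] lip_harmonic_sum[of I h c] assms(3) by simp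
qed

lemma B_limit_square:
  assumes "h \<in> lip_harmonic"
  shows "((\<lambda>n. (\<integral>z. (h z)\<^sup>2 \<partial>walk n) / real (Suc n)) \<longlongrightarrow> B h h) F"
  using B_limit[OF assms assms] by (simp add: power2_eq_square)

text \<open>Needed because the distance estimate pairs \<open>walk n\<close> with
  \<open>walk (Suc n)\<close>; the extra step changes the second moment by at most a
  constant.\<close>

lemma B_limit_square_Suc:
  assumes h: "h \<in> lip_harmonic"
  shows "((\<lambda>n. (\<integral>z. (h z)\<^sup>2 \<partial>walk (Suc n)) / real (Suc n)) \<longlongrightarrow> B h h) F"
proof -
  obtain C where C: "C \<ge> 0" "\<And>x. x \<in> carrier G \<Longrightarrow> energy (translate x h) \<le> C"
    using energy_translate_bound[OF h] by blast
  define e where "e n = ((\<integral>z. (h z)\<^sup>2 \<partial>walk (Suc n)) - (\<integral>z. (h z)\<^sup>2 \<partial>walk n)) / real (Suc n)" for n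
  have "(e \<longlongrightarrow> 0) F"
  proof (rule tendsto_rabs_zero_cancel, rule tendsto_sandwich[OF _ _ tendsto_const inverse_Suc_tendsto[of C]])
    show "\<forall>\<^sub>F n in F. \<bar>e n\<bar> \<le> C / real (Suc n)"
    proof (intro always_eventually allI)
      fix n
      have "\<bar>(\<integral>z. (h z)\<^sup>2 \<partial>walk (Suc n)) - (\<integral>z. (h z)\<^sup>2 \<partial>walk n)\<bar> \<le> C"
        using second_moment_increment(1)[OF h C(2) one_closed, of n] by (simp add: translate_one[OF h] del: walk.simps)
      then show "\<bar>e n\<bar> \<le> C / real (Suc n)"
        unfolding e_def abs_divide by (simp add: divide_right_mono del: walk.simps)
    qed
  qed auto
  from tendsto_add[OF B_limit_square[OF h] this] show ?thesis
    by (simp add: e_def[abs_def] diff_divide_distrib del: walk.simps)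
qed

lemma d_nonneg: "g \<in> set_pmf \<mu> \<Longrightarrow> 0 \<le> d g"
  by (rule tendsto_lowerbound[OF d_limit _ F_nontrivial]) (auto simp: step_hellinger_nonneg)

text \<open>For fixed \<open>m\<close>, dividing the almost-invariance estimate by n + 1 and letting
  \<open>n\<close> grow leaves 2 C sqrt (\<open>step_hellinger m g\<close>). Then \<open>m\<close>
  runs along the same filter, where this vanishes because m + 1 times the distance
  converges.\<close>

lemma B_translate_step:
  assumes h: "h \<in> lip_harmonic" and g: "g \<in> set_pmf \<mu>"
  shows "B (translate g h) (translate g h) = B h h"
proof -
  obtain C where C: "C \<ge> 0" "\<And>x. x \<in> carrier G \<Longrightarrow> energy (translate x h) \<le> C"
    using energy_translate_bound[OF h] by blast
  note T = lip_harmonic_translate[OF h step_closed[OF g]]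
  define a where "a n = (\<integral>z. (translate g h z)\<^sup>2 \<partial>walk n)" for n
  define b where "b n = (\<integral>z. (h z)\<^sup>2 \<partial>walk n)" for n
  have ab: "((\<lambda>n. \<bar>a n / real (Suc n) - b n / real (Suc n)\<bar>) \<longlongrightarrow> \<bar>B (translate g h) (translate g h) - B h h\<bar>) F"
    unfolding a_def b_def by (intro tendsto_intros B_limit_square T h)
  have le: "\<bar>B (translate g h) (translate g h) - B h h\<bar> \<le> 2 * C * sqrt (step_hellinger m g)" for m
  proof (rule tendsto_le[OF F_nontrivial _ ab])
    have "((\<lambda>n. (2 * real m + 1) * C / real (Suc n) + 2 * C * sqrt (step_hellinger m g)) \<longlongrightarrow> 0 + 2 * C * sqrt (step_hellinger m g)) F"
      by (intro tendsto_add inverse_Suc_tendsto tendsto_const)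
    then show "((\<lambda>n. (2 * real m + 1) * C / real (Suc n) + 2 * C * sqrt (step_hellinger m g)) \<longlongrightarrow> 2 * C * sqrt (step_hellinger m g)) F"
      by simp
    show "\<forall>\<^sub>F n in F. \<bar>a n / real (Suc n) - b n / real (Suc n)\<bar> \<le> (2 * real m + 1) * C / real (Suc n) + 2 * C * sqrt (step_hellinger m g)"
    proof (intro always_eventually allI)
      fix n
      have s: "0 \<le> C * sqrt (step_hellinger m g)" using C(1) step_hellinger_nonneg[of m g] by simp
      have "\<bar>a n - b n\<bar> \<le> (2 * real m + 1) * C + 2 * real n * C * sqrt (step_hellinger m g)"
        using second_moment_almost_invariant[OF h C(2) g, of n m] by (simp add: a_def b_def)
      also have "\<dots> \<le> (2 * real m + 1) * C + 2 * real (Suc n) * C * sqrt (step_hellinger m g)"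
        using s by (simp add: algebra_simps)
      finally have "\<bar>a n - b n\<bar> / real (Suc n) \<le> ((2 * real m + 1) * C + 2 * real (Suc n) * C * sqrt (step_hellinger m g)) / real (Suc n)"
        by (rule divide_right_mono) simp
      also have "\<dots> = (2 * real m + 1) * C / real (Suc n) + 2 * C * sqrt (step_hellinger m g)"
        by (simp add: add_divide_distrib del: of_nat_Suc)
      also have "\<bar>a n - b n\<bar> / real (Suc n) = \<bar>a n / real (Suc n) - b n / real (Suc n)\<bar>"
        by (simp flip: diff_divide_distrib add: abs_divide)
      finally show "\<bar>a n / real (Suc n) - b n / real (Suc n)\<bar> \<le> (2 * real m + 1) * C / real (Suc n) + 2 * C * sqrt (step_hellinger m g)" .
    qed
  qed
  have "((\<lambda>m. real (Suc m) * step_hellinger m g * (1 / real (Suc m))) \<longlongrightarrow> d g * 0) F"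
    by (intro tendsto_mult d_limit g inverse_Suc_tendsto)
  then have "((\<lambda>m. step_hellinger m g) \<longlongrightarrow> 0) F" by (simp del: of_nat_Suc)
  then have "((\<lambda>m. 2 * C * sqrt (step_hellinger m g)) \<longlongrightarrow> 2 * C * sqrt 0) F"
    by (intro tendsto_intros)
  then have "\<bar>B (translate g h) (translate g h) - B h h\<bar> \<le> 2 * C * sqrt 0"
    by (rule tendsto_lowerbound[OF _ _ F_nontrivial]) (intro always_eventually allI le)
  then show ?thesis by simp
qed

text \<open>Adaptedness as an induction principle. Generation as a semigroup means that no case for
  inverses arises.\<close>

lemma step_induct [consumes 1, case_names step mult]:
  assumes "x \<in> carrier G"
    and "\<And>g. g \<in> set_pmf \<mu> \<Longrightarrow> P g"
    and "\<And>x y. x \<in> carrier G \<Longrightarrow> y \<in> carrier G \<Longrightarrow> P x \<Longrightarrow> P y \<Longrightarrow> P (x \<otimes> y)"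
  shows "P x"
proof -
  have gen: "semigroup_generated G (set_pmf \<mu>) = carrier G" using adapted by (simp add: adapted_def)
  then have "x \<in> semigroup_generated G (set_pmf \<mu>)" using assms(1) by simp
  then show ?thesis by (induction rule: semigroup_generated.induct) (use assms(2,3) gen in auto)
qed

lemma B_translate_square:
  assumes "x \<in> carrier G" "h \<in> lip_harmonic"
  shows "B (translate x h) (translate x h) = B h h"
  using assms
proof (induction arbitrary: h rule: step_induct)
  case (step g)
  then show ?case using B_translate_step by blast
next
  case (mult x y)
  then show ?case using lip_harmonic_translate by (simp add: translate_mult)
qed

lemma B_add_square:
  assumes "h \<in> lip_harmonic" "k \<in> lip_harmonic"
  shows "B (\<lambda>z. 1 * h z + 1 * k z) (\<lambda>z. 1 * h z + 1 * k z) = B h h + 2 * B h k + B k k"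
proof -
  let ?s = "\<lambda>z. 1 * h z + 1 * k z"
  have s: "?s \<in> lip_harmonic" by (rule lip_harmonic_lincomb[OF assms])
  have "B ?s ?s = B h ?s + B k ?s" using B_lincomb[OF assms s, of 1 1] by simp
  also have "B h ?s = B h h + B h k" using B_lincomb[OF assms assms(1), of 1 1] B_sym[OF assms(1) s] B_sym[OF assms] by simp
  also have "B k ?s = B h k + B k k" using B_lincomb[OF assms assms(2), of 1 1] B_sym[OF assms(2) s] by simp
  finally show ?thesis by simp
qed

text \<open>Polarisation of the invariance of squares.\<close>

lemma B_translate:
  assumes x: "x \<in> carrier G" and h: "h \<in> lip_harmonic" and k: "k \<in> lip_harmonic"
  shows "B (translate x h) (translate x k) = B h k"
proof -
  have "translate x (\<lambda>z. 1 * h z + 1 * k z) = (\<lambda>z. 1 * translate x h z + 1 * translate x k z)"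
    by (auto simp: translate_def)
  then have "B h h + 2 * B h k + B k k
      = B (translate x h) (translate x h) + 2 * B (translate x h) (translate x k) + B (translate x k) (translate x k)"
    using B_translate_square[OF x lip_harmonic_lincomb[OF h k, of 1 1]] B_add_square[OF h k]
      B_add_square[OF lip_harmonic_translate[OF h x] lip_harmonic_translate[OF k x]] by simp
  then show ?thesis using B_translate_square[OF x h] B_translate_square[OF x k] by simp
qed

text \<open>The 4 is the 2 of the Hellinger estimate times the number of second moments involved: by
  invariance both, divided by n + 1, tend to \<open>B h h\<close>.\<close>

lemma evaluation_bound:
  assumes h: "h \<in> lip_harmonic" and g: "g \<in> set_pmf \<mu>"
  shows "(h g)\<^sup>2 \<le> 4 * d g * B h h"
proof -
  have gG: "g \<in> carrier G" using g by (rule step_closed)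
  note T = lip_harmonic_translate[OF h gG]
  \<comment> \<open>The second moments divided by n + 1, the first split by Pythagoras so that its
    summand \<open>(h g)\<^sup>2\<close> dies in the limit. The compensating factor n + 1 goes to
    \<open>step_hellinger\<close>.\<close>
  define X where "X n = (h g)\<^sup>2 / real (Suc n) + (\<integral>z. (translate g h z)\<^sup>2 \<partial>walk n) / real (Suc n)
     + (\<integral>z. (h z)\<^sup>2 \<partial>walk (Suc n)) / real (Suc n)" for n
  have "(X \<longlongrightarrow> 0 + B (translate g h) (translate g h) + B h h) F"
    unfolding X_def[abs_def]
    by (intro tendsto_add inverse_Suc_tendsto B_limit_square B_limit_square_Suc h T)
  then have "(X \<longlongrightarrow> 2 * B h h) F" by (simp add: B_translate_step[OF h g])
  then have lim: "((\<lambda>n. 2 * (real (Suc n) * step_hellinger n g) * X n) \<longlongrightarrow> 2 * d g * (2 * B h h)) F"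
    by (intro tendsto_mult tendsto_const d_limit g)
  have "(h g)\<^sup>2 \<le> 2 * d g * (2 * B h h)"
  proof (rule tendsto_lowerbound[OF lim _ F_nontrivial], intro always_eventually allI)
    fix n
    have "integrable (measure_pmf (walk n)) (\<lambda>z. (h (g \<otimes> z))\<^sup>2)"
    proof (rule integrable_cong_AE_imp)
      show "integrable (measure_pmf (walk n)) (\<lambda>z. (h g)\<^sup>2 + 2 * h g * translate g h z + (translate g h z)\<^sup>2)"
        using lip_harmonic_integrable'[OF T] lip_harmonic_square_integrable[OF T] by simp
    qed (auto intro!: AE_pmfI simp: translate_def power2_eq_square algebra_simps dest!: walk_closed)
    then have "((\<integral>z. h (g \<otimes> z) \<partial>walk n) - (\<integral>z. h z \<partial>walk (Suc n)))\<^sup>2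
     \<le> 2 * step_hellinger n g * ((\<integral>z. (h (g \<otimes> z))\<^sup>2 \<partial>walk n) + (\<integral>z. (h z)\<^sup>2 \<partial>walk (Suc n)))"
      by (intro step_expectation_diff gG lip_harmonic_integrable[OF h gG] lip_harmonic_integrable'[OF h]
          lip_harmonic_square_integrable[OF h])
    then have "(h g)\<^sup>2 \<le> 2 * step_hellinger n g * ((h g)\<^sup>2 + (\<integral>z. (translate g h z)\<^sup>2 \<partial>walk n) + (\<integral>z. (h z)\<^sup>2 \<partial>walk (Suc n)))"
      unfolding walk_mean[OF h gG] walk_mean_zero[OF h] walk_second_moment_translate[OF h gG] by (simp del: walk.simps)
    also have "\<dots> = 2 * (real (Suc n) * step_hellinger n g) * X n"
      unfolding X_def by (simp add: field_simps del: walk.simps of_nat_Suc)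
    finally show "(h g)\<^sup>2 \<le> 2 * (real (Suc n) * step_hellinger n g) * X n" .
  qed
  then show ?thesis by simp
qed

text \<open>By invariance every translate of \<open>h\<close> also has form value 0, so the
  evaluation bound forbids any step from any point to change \<open>h\<close>; adaptedness extends
  this to all of the group.\<close>

lemma B_definite:
  assumes h: "h \<in> lip_harmonic" and zero: "B h h = 0"
  shows "h = (\<lambda>_. 0)"
proof -
  have step: "h (x \<otimes> g) = h x" if x: "x \<in> carrier G" and g: "g \<in> set_pmf \<mu>" for x g
    using evaluation_bound[OF lip_harmonic_translate[OF h x] g] B_translate_square[OF x h] zero
      translate_apply[OF step_closed[OF g], of x h] by simp
  have "\<forall>x\<in>carrier G. h (x \<otimes> y) = h x" if "y \<in> carrier G" for y
    using that
  proof (induction rule: step_induct)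
    case (mult y z)
    show ?case
    proof
      fix x assume x: "x \<in> carrier G"
      have "h (x \<otimes> (y \<otimes> z)) = h ((x \<otimes> y) \<otimes> z)" using x mult by (simp add: m_assoc)
      then show "h (x \<otimes> (y \<otimes> z)) = h x" using x mult by simp
    qed
  qed (use step in blast)
  then have "h y = 0" if "y \<in> carrier G" for y
    using that lip_harmonic_one[OF h] by (metis l_one one_closed)
  then show ?thesis using lip_harmonic_outside[OF h] by auto
qed

text \<open>Translates of an orthonormal family are orthonormal, so testing the evaluation bound on the
  combination with coefficients \<open>translate x (e i) g\<close> gives Bessel's inequality with constant \<open>4 d g\<close>.
  Averaging over \<open>g\<close> bounds the summed energy, hence the sum of the \<open>B (e i) (e i)\<close>.\<close>

lemma orthonormal_card_bound:
  assumes I: "finite I" and e: "\<And>i. i \<in> I \<Longrightarrow> e i \<in> lip_harmonic"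
    and on: "\<And>i j. i \<in> I \<Longrightarrow> j \<in> I \<Longrightarrow> B (e i) (e j) = (if i = j then 1 else 0)"
  shows "real (card I) \<le> 4 * K"
proof -
  have bessel: "(\<Sum>i\<in>I. (translate x (e i) g)\<^sup>2) \<le> 4 * d g" if x: "x \<in> carrier G" and g: "g \<in> set_pmf \<mu>" for x g
  proof -
    define c where "c i = translate x (e i) g" for i
    define H where "H = (\<lambda>z. \<Sum>i\<in>I. c i * translate x (e i) z)"
    note T = lip_harmonic_translate[OF e x]
    have H: "H \<in> lip_harmonic" unfolding H_def by (rule lip_harmonic_sum[OF I T])
    have BT: "B (translate x (e i)) H = c i" if i: "i \<in> I" for i
    proof -
      have "B (translate x (e i)) H = B H (translate x (e i))" by (rule B_sym[OF T[OF i] H])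
      also have "\<dots> = (\<Sum>j\<in>I. c j * B (translate x (e j)) (translate x (e i)))"
        unfolding H_def by (rule B_sum[OF I T T[OF i]])
      also have "\<dots> = (\<Sum>j\<in>I. if j = i then c j else 0)"
        using e on i B_translate[OF x] by (intro sum.cong) auto
      also have "\<dots> = c i" using I i by simp
      finally show ?thesis .
    qed
    have "B H H = (\<Sum>i\<in>I. c i * B (translate x (e i)) H)" by (subst (1) H_def, rule B_sum[OF I T H])
    also have "\<dots> = (\<Sum>i\<in>I. (c i)\<^sup>2)" by (intro sum.cong) (auto simp: BT power2_eq_square)
    finally have BH: "B H H = (\<Sum>i\<in>I. (c i)\<^sup>2)" .
    have Hg: "H g = (\<Sum>i\<in>I. (c i)\<^sup>2)" by (simp add: H_def c_def power2_eq_square)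
    \<comment> \<open>\<open>H g\<close> and \<open>B H H\<close> are the same sum s, so the
      evaluation bound reads s^2 <= 4 d s and can be divided by s.\<close>
    have "(\<Sum>i\<in>I. (c i)\<^sup>2)\<^sup>2 \<le> 4 * d g * (\<Sum>i\<in>I. (c i)\<^sup>2)"
      using evaluation_bound[OF H g] unfolding BH Hg .
    moreover have "0 \<le> (\<Sum>i\<in>I. (c i)\<^sup>2)" by (intro sum_nonneg) auto
    ultimately have "(\<Sum>i\<in>I. (c i)\<^sup>2) \<le> 4 * d g" using d_nonneg[OF g]
      by (cases "(\<Sum>i\<in>I. (c i)\<^sup>2) = 0") (auto simp: power2_eq_square)
    then show ?thesis by (simp add: c_def)
  qed
  have energy: "(\<Sum>i\<in>I. energy (translate x (e i))) \<le> 4 * K" if x: "x \<in> carrier G" for x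
  proof -
    have int: "integrable (measure_pmf \<mu>) (\<lambda>g. (translate x (e i) g)\<^sup>2)" if "i \<in> I" for i
      by (rule lip_harmonic_square_integrable(1)[OF lip_harmonic_translate[OF e[OF that] x]])
    have "(\<Sum>i\<in>I. energy (translate x (e i))) = (\<integral>g. (\<Sum>i\<in>I. (translate x (e i) g)\<^sup>2) \<partial>\<mu>)"
      unfolding energy_def using int by simp
    also have "\<dots> \<le> 4 * K"
    proof (rule pmf_expectation_le_finite_sums)
      fix A assume A: "finite A" "A \<subseteq> set_pmf \<mu>"
      have "(\<Sum>g\<in>A. pmf \<mu> g * (\<Sum>i\<in>I. (translate x (e i) g)\<^sup>2)) \<le> (\<Sum>g\<in>A. pmf \<mu> g * (4 * d g))"
        using A bessel[OF x] by (intro sum_mono mult_left_mono) auto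
      also have "\<dots> = 4 * (\<Sum>g\<in>A. pmf \<mu> g * d g)" by (simp add: sum_distrib_left mult_ac)
      also have "\<dots> \<le> 4 * K" using d_sum[OF A] by simp
      finally show "(\<Sum>g\<in>A. pmf \<mu> g * (\<Sum>i\<in>I. (translate x (e i) g)\<^sup>2)) \<le> 4 * K" .
    qed (use int in \<open>auto intro: sum_nonneg\<close>)
    finally show ?thesis .
  qed
  have K: "0 \<le> K" using d_sum[of "{}"] by simp
  have "(\<Sum>i\<in>I. B (e i) (e i)) \<le> 4 * K"
  proof (rule tendsto_upperbound[OF _ _ F_nontrivial])
    show "((\<lambda>n. \<Sum>i\<in>I. (\<integral>z. (e i z)\<^sup>2 \<partial>walk n) / real (Suc n)) \<longlongrightarrow> (\<Sum>i\<in>I. B (e i) (e i))) F"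
      by (intro tendsto_sum B_limit_square e)
    show "\<forall>\<^sub>F n in F. (\<Sum>i\<in>I. (\<integral>z. (e i z)\<^sup>2 \<partial>walk n) / real (Suc n)) \<le> 4 * K"
    proof (intro always_eventually allI)
      fix n
      have "(\<Sum>i\<in>I. \<integral>z. (translate \<one> (e i) z)\<^sup>2 \<partial>walk n) \<le> real n * (4 * K)"
        by (rule second_moment_family_bound[OF I e energy one_closed])
      then have "(\<Sum>i\<in>I. \<integral>z. (e i z)\<^sup>2 \<partial>walk n) \<le> real n * (4 * K)"
        using e by (simp add: translate_one)
      also have "\<dots> \<le> real (Suc n) * (4 * K)" using K by (intro mult_right_mono) auto
      finally show "(\<Sum>i\<in>I. (\<integral>z. (e i z)\<^sup>2 \<partial>walk n) / real (Suc n)) \<le> 4 * K"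
        by (simp add: field_simps flip: sum_divide_distrib)
    qed
  qed
  then show ?thesis using on by simp
qed

text \<open>The cardinality bound yields an orthonormal family in \<open>U\<close> of greatest size.
  If the residual of \<open>u\<close> after projection had positive form value, normalising it would
  extend the family; so the value is 0 and definiteness makes the residual vanish pointwise.\<close>

lemma orthonormal_expansion:
  assumes UV: "U \<subseteq> lip_harmonic" and zero: "(\<lambda>_. 0) \<in> U"
    and lin: "\<And>h k a b. h \<in> U \<Longrightarrow> k \<in> U \<Longrightarrow> (\<lambda>z. a * h z + b * k z) \<in> U"
  obtains N :: nat and e where "\<And>i. i < N \<Longrightarrow> e i \<in> U"
    and "\<And>u. u \<in> U \<Longrightarrow> u = (\<lambda>z. \<Sum>i<N. B u (e i) * e i z)"
proof -
  define P where "P N \<longleftrightarrow> (\<exists>e. (\<forall>i<N. e i \<in> U) \<and> (\<forall>i<N. \<forall>j<N. B (e i) (e j) = (if i = j then 1 else 0)))" for N :: nat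
  have P0: "P 0" by (simp add: P_def)
  have bound: "N \<le> nat \<lceil>4 * K\<rceil>" if p: "P N" for N
  proof -
    obtain e where "(\<forall>i<N. e i \<in> U) \<and> (\<forall>i<N. \<forall>j<N. B (e i) (e j) = (if i = j then 1 else 0))"
      using p unfolding P_def by blast
    then have e: "\<And>i. i < N \<Longrightarrow> e i \<in> U" "\<And>i j. i < N \<Longrightarrow> j < N \<Longrightarrow> B (e i) (e j) = (if i = j then 1 else 0)"
      by blast+
    have "real (card {..<N}) \<le> 4 * K"
      by (rule orthonormal_card_bound[of "{..<N}" e]) (use e UV in auto)
    then show ?thesis by (simp add: le_nat_iff) linarith
  qed
  define N where "N = (GREATEST N. P N)"
  have PN: "P N" unfolding N_def by (rule GreatestI_nat[of P, OF P0 bound])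
  have not: "\<not> P (Suc N)" using Greatest_le_nat[of P "Suc N" "nat \<lceil>4 * K\<rceil>"] bound unfolding N_def by auto
  obtain e where "(\<forall>i<N. e i \<in> U) \<and> (\<forall>i<N. \<forall>j<N. B (e i) (e j) = (if i = j then 1 else 0))"
    using PN unfolding P_def by blast
  then have e: "\<And>i. i < N \<Longrightarrow> e i \<in> U" "\<And>i j. i < N \<Longrightarrow> j < N \<Longrightarrow> B (e i) (e j) = (if i = j then 1 else 0)"
    by blast+
  have eV: "e i \<in> lip_harmonic" if "i < N" for i using e(1) UV that by auto
  have sumU: "(\<lambda>z. \<Sum>i<m. c i * e i z) \<in> U" if "m \<le> N" for m c
    using that
  proof (induction m)
    case (Suc m)
    then show ?case using lin[of "\<lambda>z. \<Sum>i<m. c i * e i z" "e m" 1 "c m"] e(1)[of m] by simp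
  qed (simp add: zero)
  have "u = (\<lambda>z. \<Sum>i<N. B u (e i) * e i z)" if u: "u \<in> U" for u
  proof -
    define s where "s = (\<lambda>z. \<Sum>i<N. B u (e i) * e i z)"
    define r where "r = (\<lambda>z. 1 * u z + (-1) * s z)"
    have sU: "s \<in> U" unfolding s_def by (rule sumU) simp
    have rU: "r \<in> U" unfolding r_def by (rule lin[OF u sU])
    have V: "u \<in> lip_harmonic" "s \<in> lip_harmonic" "r \<in> lip_harmonic" using u sU rU UV by auto
    have orth: "B r (e j) = 0" if j: "j < N" for j
    proof -
      have "B s (e j) = (\<Sum>i<N. B u (e i) * B (e i) (e j))"
        unfolding s_def by (rule B_sum) (use eV j in auto)
      also have "\<dots> = (\<Sum>i<N. if i = j then B u (e i) else 0)" using e(2) j by (intro sum.cong) auto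
      also have "\<dots> = B u (e j)" using j by simp
      finally show ?thesis unfolding r_def using B_lincomb[OF V(1,2) eV[OF j], of 1 "-1"] by simp
    qed
    have "B r r = 0"
    proof (rule ccontr)
      assume "B r r \<noteq> 0"
      then have pos: "B r r > 0" using B_nonneg[OF V(3)] by simp
      define t where "t = 1 / sqrt (B r r)"
      define v where "v = (\<lambda>z. t * r z + 0 * r z)"
      have vU: "v \<in> U" unfolding v_def by (rule lin[OF rU rU])
      have vV: "v \<in> lip_harmonic" using vU UV by auto
      have Bv: "B v l = t * B r l" if "l \<in> lip_harmonic" for l
        unfolding v_def using B_lincomb[OF V(3) V(3) that, of t 0] by simp
      have "B v v = t * (t * B r r)" using Bv[OF vV] Bv[OF V(3)] B_sym[OF vV V(3)] by simp
      also have "\<dots> = 1" using pos by (simp add: t_def)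
      finally have vv: "B v v = 1" .
      have ve: "B v (e j) = 0" "B (e j) v = 0" if "j < N" for j
        using Bv[OF eV[OF that]] orth[OF that] B_sym[OF eV[OF that] vV] by auto
      have "P (Suc N)" unfolding P_def
        by (rule exI[of _ "e(N := v)"]) (use e ve vv vU in \<open>auto simp: less_Suc_eq\<close>)
      then show False using not by simp
    qed
    then have "r = (\<lambda>_. 0)" by (rule B_definite[OF V(3)])
    then have "u z = s z" for z unfolding r_def by (auto dest: fun_cong[of _ _ z])
    then show ?thesis unfolding s_def by auto
  qed
  then show ?thesis using that e(1) by blast
qed

end

section \<open>Sublinear functions and averages over balls\<close>

context growth_walk
begin

text \<open>Growth o(\<open>len\<close>) in a form without filters: the constant absorbs the ball on
  which the asymptotic bound says nothing, and stability under translation becomes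
  immediate.\<close>

definition sublinear :: "('a \<Rightarrow> real) \<Rightarrow> bool" where
  "sublinear h \<longleftrightarrow> (\<forall>\<epsilon>>0. \<exists>C. \<forall>z\<in>carrier G. \<bar>h z\<bar> \<le> \<epsilon> * len z + C)"

lemma sublinear_nonneg_bound:
  assumes "sublinear h" "\<epsilon> > 0"
  obtains C where "C \<ge> 0" "\<And>z. z \<in> carrier G \<Longrightarrow> \<bar>h z\<bar> \<le> \<epsilon> * len z + C"
proof -
  obtain C where C: "\<forall>z\<in>carrier G. \<bar>h z\<bar> \<le> \<epsilon> * len z + C" using assms unfolding sublinear_def by blast
  show ?thesis by (rule that[of "max C 0"]) (use C in \<open>force simp: max_def\<close>)+
qed

lemma sublinear_translate:
  assumes h: "sublinear h" and x: "x \<in> carrier G"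
  shows "sublinear (translate x h)"
  unfolding sublinear_def
proof (intro allI impI)
  fix \<epsilon> :: real assume e: "\<epsilon> > 0"
  obtain C where C: "C \<ge> 0" "\<And>z. z \<in> carrier G \<Longrightarrow> \<bar>h z\<bar> \<le> \<epsilon> * len z + C"
    using sublinear_nonneg_bound[OF h e] by blast
  have "\<bar>translate x h z\<bar> \<le> \<epsilon> * len z + (\<epsilon> * len x + C + \<bar>h x\<bar>)" if z: "z \<in> carrier G" for z
  proof -
    have "\<bar>translate x h z\<bar> \<le> \<bar>h (x \<otimes> z)\<bar> + \<bar>h x\<bar>" using z by (simp add: translate_apply)
    moreover have "\<epsilon> * len (x \<otimes> z) \<le> \<epsilon> * (len x + len z)" using len_mult[OF x z] e by (intro mult_left_mono) auto
    ultimately show ?thesis using C(2)[OF m_closed[OF x z]] by (simp add: algebra_simps)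
  qed
  then show "\<exists>C. \<forall>z\<in>carrier G. \<bar>translate x h z\<bar> \<le> \<epsilon> * len z + C" by blast
qed

abbreviation ball_size :: "nat \<Rightarrow> real" where "ball_size n \<equiv> real (card (word_ball G S n))"

lemma finite_ball: "finite (word_ball G S n)"
  by (rule finite_word_ball[OF generators finite_generators])

lemma ball_size_ge_1: "1 \<le> ball_size n"
proof -
  have "\<one> \<in> word_ball G S n" by (simp add: word_ball_def word_length_one)
  then have "card (word_ball G S n) \<noteq> 0" using finite_ball by auto
  then show ?thesis by simp
qed

text \<open>The volume counterpart of the entropy argument: the logarithm of the ball volume grows
  at most logarithmically, so its increments are infinitely often O(1/n), and exponentiating gives a
  small relative sphere.\<close>

lemma ball_size_increment:
  obtains K where "K > 0" "\<exists>\<^sub>\<infinity>n. ball_size (Suc n) - ball_size n \<le> K / real (Suc n) * ball_size n"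
proof -
  obtain C m where C: "\<And>n. n \<ge> 1 \<Longrightarrow> ball_size n \<le> C * real n ^ m"
    using growth by (auto simp: polynomial_growth_def)
  have C0: "C > 0" using C[of 1] ball_size_ge_1[of 1] by simp
  have "ln (ball_size n) \<le> ln C + real m * ln (real n)" if n: "n \<ge> 1" for n
  proof -
    have "ln (ball_size n) \<le> ln (C * real n ^ m)" using C[OF n] ball_size_ge_1[of n] by simp
    also have "\<dots> = ln C + real m * ln (real n)" using C0 n by (simp add: ln_mult ln_realpow)
    finally show ?thesis .
  qed
  then obtain K where K: "K > 0" "\<exists>\<^sub>\<infinity>n. ln (ball_size (Suc n)) - ln (ball_size n) \<le> K / real (Suc n)"
    using log_growth_small_increments[of "\<lambda>n. ln (ball_size n)" "ln C" "real m"] by blast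
  have "ball_size (Suc n) - ball_size n \<le> K * exp K / real (Suc n) * ball_size n"
    if le: "ln (ball_size (Suc n)) - ln (ball_size n) \<le> K / real (Suc n)" for n
  proof -
    define x where "x = K / real (Suc n)"
    have x: "0 \<le> x" "x \<le> K" using K(1) by (auto simp: x_def field_simps)
    have "ln (ball_size (Suc n)) \<le> ln (exp x * ball_size n)"
      using le ball_size_ge_1[of n] by (simp add: ln_mult x_def)
    then have "ball_size (Suc n) \<le> exp x * ball_size n"
      using ball_size_ge_1[of n] ball_size_ge_1[of "Suc n"] by (subst (asm) ln_le_cancel_iff) auto
    then have "ball_size (Suc n) - ball_size n \<le> (exp x - 1) * ball_size n" by (simp add: algebra_simps)
    \<comment> \<open>Linearises the exponential on [0, K]: 1 - x <= exp (-x) gives exp x - 1 <= x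
      exp x.\<close>
    also have "\<dots> \<le> (x * exp K) * ball_size n"
    proof (intro mult_right_mono)
      have "(1 - x) * exp x \<le> exp (- x) * exp x"
        using exp_ge_add_one_self[of "- x"] by (intro mult_right_mono) auto
      then have "exp x - 1 \<le> x * exp x" by (simp add: algebra_simps flip: exp_add)
      also have "\<dots> \<le> x * exp K" using x by (intro mult_left_mono) auto
      finally show "exp x - 1 \<le> x * exp K" .
    qed simp
    finally show ?thesis by (simp add: x_def)
  qed
  then have "\<exists>\<^sub>\<infinity>n. ball_size (Suc n) - ball_size n \<le> K * exp K / real (Suc n) * ball_size n"
    by (intro INFM_mono[OF K(2)]) auto
  then show ?thesis using that[of "K * exp K"] K(1) by simp
qed

definition ball_mean :: "nat \<Rightarrow> ('a \<Rightarrow> real) \<Rightarrow> real" where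
  "ball_mean n h = (\<Sum>z\<in>word_ball G S n. h z) / ball_size n"

text \<open>The ball and its translate by \<open>s\<close> have equal size and both lie in the next
  larger ball. Their common part cancels, and each of the two differences has at most as many points
  as the outer sphere.\<close>

lemma ball_mean_shift_bound:
  assumes s: "s \<in> S" and M: "\<And>z. z \<in> word_ball G S (Suc n) \<Longrightarrow> \<bar>h z\<bar> \<le> M"
  shows "\<bar>ball_mean n h - ball_mean n (\<lambda>z. h (s \<otimes> z))\<bar> \<le> 2 * M * (ball_size (Suc n) - ball_size n) / ball_size n"
proof -
  let ?A = "word_ball G S n"
  let ?B = "(\<lambda>z. s \<otimes> z) ` ?A"
  have sG: "s \<in> carrier G" using s generators by (auto simp: symmetric_generating_set_def)
  have AG: "?A \<subseteq> carrier G" by (auto simp: word_ball_def)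
  have inj: "inj_on (\<lambda>z. s \<otimes> z) ?A"
  proof (rule inj_onI)
    fix x y assume "x \<in> ?A" "y \<in> ?A" "s \<otimes> x = s \<otimes> y"
    then show "x = y" using sG AG by (metis Units_eq Units_l_cancel subsetD)
  qed
  have sub: "?A \<subseteq> word_ball G S (Suc n)" "?B \<subseteq> word_ball G S (Suc n)"
  proof -
    show "?A \<subseteq> word_ball G S (Suc n)" by (auto simp: word_ball_def)
    have "word_length G S (s \<otimes> z) \<le> Suc n" if "z \<in> ?A" for z
      using that word_length_mult[OF generators sG, of z] word_length_generator[OF generators s]
      by (auto simp: word_ball_def)
    then show "?B \<subseteq> word_ball G S (Suc n)" using sG by (auto simp: word_ball_def)
  qed
  have fin: "finite ?A" "finite ?B" using finite_ball by auto
  have cB: "card ?B = card ?A" by (rule card_image[OF inj])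
  have cBA: "real (card (?B - ?A)) \<le> ball_size (Suc n) - ball_size n"
  proof -
    have "card (?B - ?A) \<le> card (word_ball G S (Suc n) - ?A)"
      using sub finite_ball by (intro card_mono) auto
    also have "\<dots> = card (word_ball G S (Suc n)) - card ?A" using sub fin by (intro card_Diff_subset) auto
    finally show ?thesis using card_mono[OF finite_ball sub(1)] by linarith
  qed
  have "card (?A - ?B) = card (?B - ?A)"
    using card_Int_Diff[OF fin(1), of ?B] card_Int_Diff[OF fin(2), of ?A] cB by (simp add: Int_commute)
  then have cAB: "real (card (?A - ?B)) \<le> ball_size (Suc n) - ball_size n" using cBA by simp
  have M0: "0 \<le> M" using M[of \<one>] by (simp add: word_ball_def word_length_one)
  have sumM: "\<bar>\<Sum>z\<in>X. h z\<bar> \<le> M * (ball_size (Suc n) - ball_size n)"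
    if "X \<subseteq> word_ball G S (Suc n)" "real (card X) \<le> ball_size (Suc n) - ball_size n" for X
  proof -
    have "\<bar>\<Sum>z\<in>X. h z\<bar> \<le> (\<Sum>z\<in>X. \<bar>h z\<bar>)" by (rule sum_abs)
    also have "\<dots> \<le> real (card X) * M" using M that(1) by (intro sum_bounded_above) auto
    also have "\<dots> \<le> M * (ball_size (Suc n) - ball_size n)" using that(2) M0 by (simp add: mult.commute mult_left_mono)
    finally show ?thesis .
  qed
  have "(\<Sum>z\<in>?A. h (s \<otimes> z)) = (\<Sum>z\<in>?B. h z)" by (simp add: sum.reindex[OF inj])
  moreover have "(\<Sum>z\<in>?A. h z) = (\<Sum>z\<in>?A \<inter> ?B. h z) + (\<Sum>z\<in>?A - ?B. h z)" by (rule sum.Int_Diff[OF fin(1)])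
  moreover have "(\<Sum>z\<in>?B. h z) = (\<Sum>z\<in>?A \<inter> ?B. h z) + (\<Sum>z\<in>?B - ?A. h z)"
    using sum.Int_Diff[OF fin(2), of h ?A] by (simp add: Int_commute)
  moreover have "\<bar>\<Sum>z\<in>?A - ?B. h z\<bar> \<le> M * (ball_size (Suc n) - ball_size n)"
    "\<bar>\<Sum>z\<in>?B - ?A. h z\<bar> \<le> M * (ball_size (Suc n) - ball_size n)"
    by (rule sumM; use sub cAB cBA in blast)+
  ultimately have "\<bar>(\<Sum>z\<in>?A. h z) - (\<Sum>z\<in>?A. h (s \<otimes> z))\<bar> \<le> 2 * M * (ball_size (Suc n) - ball_size n)"
    by linarith
  then have "\<bar>(\<Sum>z\<in>?A. h z) - (\<Sum>z\<in>?A. h (s \<otimes> z))\<bar> / ball_size n \<le> 2 * M * (ball_size (Suc n) - ball_size n) / ball_size n"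
    by (rule divide_right_mono) simp
  then show ?thesis by (simp add: ball_mean_def abs_divide flip: diff_divide_distrib)
qed

lemma ball_mean_translate:
  "x \<in> carrier G \<Longrightarrow> ball_mean n (translate x h) = ball_mean n (\<lambda>z. h (x \<otimes> z)) - h x"
proof -
  assume "x \<in> carrier G"
  have "(\<Sum>z\<in>word_ball G S n. translate x h z) = (\<Sum>z\<in>word_ball G S n. h (x \<otimes> z) - h x)"
    by (intro sum.cong) (auto simp: word_ball_def translate_def)
  then show ?thesis using ball_size_ge_1[of n] by (simp add: ball_mean_def sum_subtractf diff_divide_distrib)
qed

lemma ball_mean_sum: "ball_mean n (\<lambda>z. \<Sum>i\<in>I. c i * h i z) = (\<Sum>i\<in>I. c i * ball_mean n (h i))"
  unfolding ball_mean_def by (subst sum.swap) (simp add: sum_distrib_left sum_divide_distrib)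

lemma ball_mean_lincomb: "ball_mean n (\<lambda>z. a * h z + b * k z) = a * ball_mean n h + b * ball_mean n k"
  by (simp add: ball_mean_def sum.distrib sum_distrib_left add_divide_distrib)

text \<open>Along radii with relatively small spheres, the shift error is at most a boundary share of
  order \<open>1/n\<close> times the maximum \<open>o(n)\<close> of a sublinear function.\<close>

lemma ball_mean_asymptotically_invariant:
  obtains E where "E \<noteq> bot"
    "\<And>h g. sublinear h \<Longrightarrow> h \<in> lip_harmonic \<Longrightarrow> g \<in> carrier G \<Longrightarrow>
       ((\<lambda>n. ball_mean n h - ball_mean n (translate g h)) \<longlongrightarrow> h g) E"
proof -
  obtain K where K: "K > 0" "\<exists>\<^sub>\<infinity>n. ball_size (Suc n) - ball_size n \<le> K / real (Suc n) * ball_size n"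
    using ball_size_increment by blast
  define N where "N = {n. ball_size (Suc n) - ball_size n \<le> K / real (Suc n) * ball_size n}"
  define E where "E = inf sequentially (principal N)"
  have E: "E \<noteq> bot"
  proof
    assume "E = bot"
    then have "eventually (\<lambda>_. False) E" by simp
    then have "eventually (\<lambda>n. n \<notin> N) sequentially" unfolding E_def eventually_inf_principal by simp
    then show False using K(2) by (simp add: frequently_def cofinite_eq_sequentially N_def)
  qed
  have gen: "((\<lambda>n. ball_mean n h - ball_mean n (translate s h)) \<longlongrightarrow> h s) E"
    if h: "sublinear h" and s: "s \<in> S" for h s
  proof -
    have sG: "s \<in> carrier G" using s generators by (auto simp: symmetric_generating_set_def)
    have "((\<lambda>n. ball_mean n h - ball_mean n (\<lambda>z. h (s \<otimes> z))) \<longlongrightarrow> 0) E"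
    proof (rule tendstoI)
      fix r :: real assume r: "r > 0"
      \<comment> \<open>Chosen so that the linear part of the error,
        \<open>2 * K * \<epsilon>\<close>, is \<open>r / 2\<close>; the constant \<open>C\<close>
        contributes only O(1/n).\<close>
      define \<epsilon> where "\<epsilon> = r / (4 * K)"
      have e: "\<epsilon> > 0" using r K by (simp add: \<epsilon>_def)
      obtain C where C: "C \<ge> 0" "\<And>z. z \<in> carrier G \<Longrightarrow> \<bar>h z\<bar> \<le> \<epsilon> * len z + C"
        using sublinear_nonneg_bound[OF h e] by blast
      have "((\<lambda>n. 2 * K * C / real (Suc n)) \<longlongrightarrow> 0) sequentially" by real_asymp
      then have "\<forall>\<^sub>F n in sequentially. 2 * K * C / real (Suc n) < r / 2"
        by (rule order_tendstoD) (use r in simp)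
      then have "\<forall>\<^sub>F n in E. 2 * K * C / real (Suc n) < r / 2 \<and> n \<in> N"
        unfolding E_def eventually_inf_principal by (rule eventually_mono) simp
      then show "\<forall>\<^sub>F n in E. dist (ball_mean n h - ball_mean n (\<lambda>z. h (s \<otimes> z))) 0 < r"
      proof eventually_elim
        case (elim n)
        have M: "\<bar>h z\<bar> \<le> \<epsilon> * real (Suc n) + C" if "z \<in> word_ball G S (Suc n)" for z
        proof -
          have "\<epsilon> * len z \<le> \<epsilon> * real (Suc n)" using that e by (intro mult_left_mono) (auto simp: word_ball_def)
          then show ?thesis using C(2)[of z] that by (auto simp: word_ball_def)
        qed
        have "\<bar>ball_mean n h - ball_mean n (\<lambda>z. h (s \<otimes> z))\<bar>
            \<le> 2 * (\<epsilon> * real (Suc n) + C) * (ball_size (Suc n) - ball_size n) / ball_size n"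
          by (rule ball_mean_shift_bound[OF s M])
        also have "\<dots> \<le> 2 * (\<epsilon> * real (Suc n) + C) * (K / real (Suc n) * ball_size n) / ball_size n"
          using elim e C(1) unfolding N_def
          by (intro divide_right_mono mult_left_mono) auto
        also have "\<dots> = 2 * (\<epsilon> * real (Suc n) + C) * (K / real (Suc n))"
          using ball_size_ge_1[of n] by (simp del: of_nat_Suc)
        also have "\<dots> = 2 * K * \<epsilon> + 2 * K * C / real (Suc n)" by (simp add: field_simps del: of_nat_Suc)
        also have "2 * K * \<epsilon> = r / 2" using K by (simp add: \<epsilon>_def)
        finally show ?case using elim by simp
      qed
    qed
    from tendsto_add[OF this tendsto_const[of "h s"]] show ?thesis
      by (simp add: ball_mean_translate[OF sG] algebra_simps)
  qed
  have "((\<lambda>n. ball_mean n h - ball_mean n (translate g h)) \<longlongrightarrow> h g) E"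
    if "g \<in> generate G S" "sublinear h" "h \<in> lip_harmonic" for g h
    using that
  proof (induction arbitrary: h rule: generate.induct)
    case one
    then show ?case by (simp add: translate_one lip_harmonic_one)
  next
    case (incl s)
    then show ?case using gen by blast
  next
    case (inv s)
    then show ?case using gen generators by (auto simp: symmetric_generating_set_def)
  next
    \<comment> \<open>Telescoping through \<open>translate x h\<close>, using the cocycle identity
      h(xy) = h(x) + (\<open>translate x h\<close>)(y).\<close>
    case (eng x y)
    have xy: "x \<in> carrier G" "y \<in> carrier G"
      using eng generators by (auto simp: symmetric_generating_set_def)
    have "((\<lambda>n. (ball_mean n h - ball_mean n (translate x h)) + (ball_mean n (translate x h) - ball_mean n (translate y (translate x h))))
       \<longlongrightarrow> h x + translate x h y) E"
      by (intro tendsto_add eng.IH eng.prems sublinear_translate lip_harmonic_translate xy)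
    then show ?case using xy by (simp add: translate_mult translate_apply)
  qed
  then have "((\<lambda>n. ball_mean n h - ball_mean n (translate g h)) \<longlongrightarrow> h g) E"
    if "g \<in> carrier G" "sublinear h" "h \<in> lip_harmonic" for g h
    using that generators by (simp add: symmetric_generating_set_def)
  with E show ?thesis using that by blast
qed

end

section \<open>Vanishing of sublinear harmonic functions\<close>

context walk_limit
begin

text \<open>Positivity at h + k and h - k gives this weak Cauchy-Schwarz inequality; its right side
  does not change when \<open>h\<close> is translated, which is the uniformity needed.\<close>

lemma B_abs_le:
  assumes h: "h \<in> lip_harmonic" and k: "k \<in> lip_harmonic"
  shows "\<bar>B h k\<bar> \<le> B h h + B k k"
proof -
  let ?m = "\<lambda>z. (-1) * k z + 0 * k z"
  have m: "?m \<in> lip_harmonic" by (rule lip_harmonic_lincomb[OF k k])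
  have Bm: "B ?m l = - B k l" if "l \<in> lip_harmonic" for l
    using B_lincomb[OF k k that, of "-1" 0] by simp
  have "B h ?m = - B h k" using Bm[OF h] B_sym[OF h m] B_sym[OF h k] by simp
  moreover have "B ?m ?m = B k k" using Bm[OF m] Bm[OF k] B_sym[OF m k] by simp
  ultimately have "0 \<le> B h h - 2 * B h k + B k k"
    using B_add_square[OF h m] B_nonneg[OF lip_harmonic_lincomb[OF h m, of 1 1]] by simp
  moreover have "0 \<le> B h h + 2 * B h k + B k k"
    using B_add_square[OF h k] B_nonneg[OF lip_harmonic_lincomb[OF h k, of 1 1]] by simp
  ultimately show ?thesis using B_nonneg[OF h] B_nonneg[OF k] by linarith
qed

lemma bounded_lip_harmonic_trivial:
  assumes h: "h \<in> lip_harmonic" and M: "\<And>z. z \<in> carrier G \<Longrightarrow> \<bar>h z\<bar> \<le> M"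
  shows "h = (\<lambda>_. 0)"
proof (rule B_definite[OF h])
  have "B h h \<le> 0"
  proof (rule tendsto_le[OF F_nontrivial inverse_Suc_tendsto[of "M\<^sup>2"] B_limit_square[OF h]], intro always_eventually allI)
    fix n
    have "(\<integral>z. (h z)\<^sup>2 \<partial>walk n) \<le> (\<integral>z. M\<^sup>2 \<partial>walk n)"
    proof (intro integral_mono_AE AE_pmfI)
      fix z assume "z \<in> set_pmf (walk n)"
      then have "\<bar>h z\<bar>\<^sup>2 \<le> M\<^sup>2" by (intro power_mono M walk_closed) auto
      then show "(h z)\<^sup>2 \<le> M\<^sup>2" by simp
    qed (use lip_harmonic_square_integrable[OF h] in auto)
    then show "(\<integral>z. (h z)\<^sup>2 \<partial>walk n) / real (Suc n) \<le> M\<^sup>2 / real (Suc n)"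
      by (intro divide_right_mono) auto
  qed
  then show "B h h = 0" using B_nonneg[OF h] by simp
qed

lemma sublinear_lip_harmonic_trivial:
  assumes h: "h \<in> lip_harmonic" and sub: "sublinear h"
  shows "h = (\<lambda>_. 0)"
proof -
  obtain E where E: "E \<noteq> bot"
    "\<And>h g. sublinear h \<Longrightarrow> h \<in> lip_harmonic \<Longrightarrow> g \<in> carrier G \<Longrightarrow>
       ((\<lambda>n. ball_mean n h - ball_mean n (translate g h)) \<longlongrightarrow> h g) E"
    using ball_mean_asymptotically_invariant by blast
  \<comment> \<open>The functions on which averaging along \<open>E\<close> is defined. It need not
    contain \<open>h\<close>, but contains each difference of \<open>h\<close> and a translate, with
    limit equal to the value of \<open>h\<close>.\<close>
  define U where "U = {u \<in> lip_harmonic. \<exists>l. ((\<lambda>n. ball_mean n u) \<longlongrightarrow> l) E}"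
  have U: "U \<subseteq> lip_harmonic" "(\<lambda>_. 0) \<in> U"
    by (auto simp: U_def lip_harmonic_zero ball_mean_def)
  have Ulin: "(\<lambda>z. a * u z + b * v z) \<in> U" if uv: "u \<in> U" "v \<in> U" for u v a b
  proof -
    obtain l m where "((\<lambda>n. ball_mean n u) \<longlongrightarrow> l) E" "((\<lambda>n. ball_mean n v) \<longlongrightarrow> m) E"
      using uv by (auto simp: U_def)
    then have "((\<lambda>n. ball_mean n (\<lambda>z. a * u z + b * v z)) \<longlongrightarrow> a * l + b * m) E"
      unfolding ball_mean_lincomb by (intro tendsto_intros)
    then show ?thesis using uv lip_harmonic_lincomb by (auto simp: U_def)
  qed
  obtain N :: nat and e where eU: "\<And>i. i < N \<Longrightarrow> e i \<in> U"
    and exp: "\<And>u. u \<in> U \<Longrightarrow> u = (\<lambda>z. \<Sum>i<N. B u (e i) * e i z)"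
    using orthonormal_expansion[OF U Ulin] by blast
  have eV: "e i \<in> lip_harmonic" if "i < N" for i using eU[OF that] U(1) by blast
  have "\<forall>i. \<exists>l. i < N \<longrightarrow> ((\<lambda>n. ball_mean n (e i)) \<longlongrightarrow> l) E" using eU by (auto simp: U_def)
  then obtain \<xi> where xi: "\<And>i. i < N \<Longrightarrow> ((\<lambda>n. ball_mean n (e i)) \<longlongrightarrow> \<xi> i) E" by metis
  \<comment> \<open>Independent of the translating element: the i-th coefficient of \<open>h\<close>
    minus any translate is at most twice \<open>B h h + B (e i) (e i)\<close>.\<close>
  define M where "M = (\<Sum>i<N. 2 * (B h h + B (e i) (e i)) * \<bar>\<xi> i\<bar>)"
  have "\<bar>h g\<bar> \<le> M" if g: "g \<in> carrier G" for g
  proof -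
    note T = lip_harmonic_translate[OF h g]
    define u where "u = (\<lambda>z. 1 * h z + (-1) * translate g h z)"
    have uV: "u \<in> lip_harmonic" unfolding u_def by (rule lip_harmonic_lincomb[OF h T])
    have ulim: "((\<lambda>n. ball_mean n u) \<longlongrightarrow> h g) E"
      using E(2)[OF sub h g] unfolding u_def ball_mean_lincomb by simp
    then have uU: "u \<in> U" using uV by (auto simp: U_def)
    have "((\<lambda>n. ball_mean n (\<lambda>z. \<Sum>i<N. B u (e i) * e i z)) \<longlongrightarrow> (\<Sum>i<N. B u (e i) * \<xi> i)) E"
      unfolding ball_mean_sum by (intro tendsto_sum tendsto_mult tendsto_const xi) auto
    then have "((\<lambda>n. ball_mean n u) \<longlongrightarrow> (\<Sum>i<N. B u (e i) * \<xi> i)) E"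
      by (subst exp[OF uU])
    then have "h g = (\<Sum>i<N. B u (e i) * \<xi> i)" using ulim tendsto_unique[OF E(1)] by blast
    also have "\<bar>\<dots>\<bar> \<le> (\<Sum>i<N. \<bar>B u (e i)\<bar> * \<bar>\<xi> i\<bar>)" using sum_abs[of "\<lambda>i. B u (e i) * \<xi> i"] by (simp add: abs_mult)
    also have "\<dots> \<le> M" unfolding M_def
    proof (intro sum_mono mult_right_mono)
      fix i assume "i \<in> {..<N}"
      then have ei: "e i \<in> lip_harmonic" using eV by simp
      have "B u (e i) = B h (e i) - B (translate g h) (e i)"
        unfolding u_def using B_lincomb[OF h T ei, of 1 "-1"] by simp
      then have "\<bar>B u (e i)\<bar> \<le> \<bar>B h (e i)\<bar> + \<bar>B (translate g h) (e i)\<bar>"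
        using abs_triangle_ineq4 by simp
      also have "\<dots> \<le> (B h h + B (e i) (e i)) + (B h h + B (e i) (e i))"
        using B_abs_le[OF h ei] B_abs_le[OF T ei] unfolding B_translate_square[OF g h] by (rule add_mono)
      finally show "\<bar>B u (e i)\<bar> \<le> 2 * (B h h + B (e i) (e i))" by simp
    qed simp
    finally show ?thesis .
  qed
  then show ?thesis by (rule bounded_lip_harmonic_trivial[OF h])
qed

end

section \<open>From complex Lipschitz harmonic functions to real ones\<close>

context growth_walk
begin

text \<open>Meant for \<open>\<phi>\<close> the real or imaginary part: a bounded linear map
  commutes with expectations, and contraction preserves the Lipschitz and growth bounds.\<close>

lemma sublinear_LHF_component_constant:
  fixes \<phi> :: "complex \<Rightarrow> real"
  assumes f: "f \<in> LHF G S \<mu>"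
    and o: "(\<lambda>x. cmod (f x)) \<in> o[(word_length G S) going_to at_top within carrier G](\<lambda>x. len x)"
    and lin: "bounded_linear \<phi>" and le: "\<And>z. \<bar>\<phi> z\<bar> \<le> cmod z" and x: "x \<in> carrier G"
  shows "\<phi> (f x) = \<phi> (f \<one>)"
proof -
  interpret \<phi>: bounded_linear \<phi> by (rule lin)
  define u where "u z = (if z \<in> carrier G then \<phi> (f z) - \<phi> (f \<one>) else 0)" for z
  have harm: "harmonic G \<mu> f" and lip: "lipschitz G S f" using f by (auto simp: LHF_def)
  obtain L where L: "\<And>s x. s \<in> S \<Longrightarrow> x \<in> carrier G \<Longrightarrow> cmod (f (x \<otimes> s) - f x) \<le> L"
    using lip unfolding lipschitz_def bdd_above_def by force
  have fl: "\<bar>\<phi> (f (x \<otimes> y)) - \<phi> (f x)\<bar> \<le> L * len y" if "x \<in> carrier G" "y \<in> carrier G" for x y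
  proof (rule lipschitz_along_words[OF generators _ that, of "\<lambda>z. \<phi> (f z)"])
    fix x s assume "x \<in> carrier G" "s \<in> S"
    then show "\<bar>\<phi> (f (x \<otimes> s)) - \<phi> (f x)\<bar> \<le> L"
      using le[of "f (x \<otimes> s) - f x"] L[of s x] by (simp add: \<phi>.diff)
  qed
  have mean: "integrable (measure_pmf \<mu>) (\<lambda>g. f (k \<otimes> g))" "(\<integral>g. f (k \<otimes> g) \<partial>\<mu>) = f k" if "k \<in> carrier G" for k
  proof -
    show int: "integrable (measure_pmf \<mu>) (\<lambda>g. f (k \<otimes> g))"
      using harm that by (subst pmf_integrable_iff_summable_on[OF step_support]) (auto simp: harmonic_def scaleR_conv_of_real)
    show "(\<integral>g. f (k \<otimes> g) \<partial>\<mu>) = f k"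
      using harm that by (subst pmf_expectation_eq_infsum[OF step_support int]) (auto simp: harmonic_def scaleR_conv_of_real)
  qed
  have "u \<in> lip_harmonic"
  proof (rule lip_harmonicI[of _ L])
    fix k assume k: "k \<in> carrier G"
    have "(\<integral>g. u (k \<otimes> g) \<partial>\<mu>) = (\<integral>g. \<phi> (f (k \<otimes> g)) - \<phi> (f \<one>) \<partial>\<mu>)"
      using k by (intro integral_cong_AE AE_pmfI) (auto simp: u_def dest: step_closed)
    also have "\<dots> = \<phi> (f k) - \<phi> (f \<one>)"
      using integrable_bounded_linear[OF lin mean(1)[OF k]] integral_bounded_linear[OF lin mean(1)[OF k]] mean(2)[OF k] by simp
    finally show "(\<integral>g. u (k \<otimes> g) \<partial>\<mu>) = u k" using k by (simp add: u_def)
  qed (use fl in \<open>auto simp: u_def\<close>)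
  moreover have "sublinear u"
    unfolding sublinear_def
  proof (intro allI impI)
    fix \<epsilon> :: real assume e: "\<epsilon> > 0"
    from landau_o.smallD[OF o e]
    obtain n where n: "\<And>z. z \<in> carrier G \<Longrightarrow> word_length G S z \<ge> n \<Longrightarrow> cmod (f z) \<le> \<epsilon> * len z"
      unfolding eventually_going_to_at_top_linorder by auto
    \<comment> \<open>Covers the ball of radius below \<open>n\<close>, about which the asymptotic
      bound is silent. If \<open>S\<close> is empty, \<open>L\<close> may have any sign, hence its
      absolute value.\<close>
    have L0: "\<bar>\<phi> (f z) - \<phi> (f \<one>)\<bar> \<le> \<bar>L\<bar> * len z" if "z \<in> carrier G" for z
      using order.trans[OF fl[OF one_closed that] mult_right_mono[OF abs_ge_self]] that by simp
    have "\<bar>u z\<bar> \<le> \<epsilon> * len z + (\<bar>L\<bar> * real n + \<bar>\<phi> (f \<one>)\<bar>)" if z: "z \<in> carrier G" for z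
    proof (cases "word_length G S z \<ge> n")
      case True
      have "\<bar>u z\<bar> \<le> cmod (f z) + \<bar>\<phi> (f \<one>)\<bar>" using le[of "f z"] z by (simp add: u_def)
      then show ?thesis using n[OF z True] mult_nonneg_nonneg[of "\<bar>L\<bar>" "real n"] by linarith
    next
      case False
      then have "\<bar>L\<bar> * len z \<le> \<bar>L\<bar> * real n" by (intro mult_left_mono) auto
      then have "\<bar>u z\<bar> \<le> \<bar>L\<bar> * real n" using L0[OF z] z by (simp add: u_def)
      then show ?thesis using mult_nonneg_nonneg[of \<epsilon> "len z"] e by linarith
    qed
    then show "\<exists>C. \<forall>z\<in>carrier G. \<bar>u z\<bar> \<le> \<epsilon> * len z + C" by blast
  qed
  moreover obtain F B d K where "walk_limit G S \<mu> F B d K" using walk_limit_exists by blast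
  ultimately have "u = (\<lambda>_. 0)" by (intro walk_limit.sublinear_lip_harmonic_trivial)
  then have "u x = 0" by simp
  then show ?thesis using x by (simp add: u_def)
qed

end

theorem corollary5p5:
  fixes G :: "('a, 'b) monoid_scheme" (structure) and S :: "'a set" and \<mu> :: "'a pmf" and f :: "'a \<Rightarrow> complex"
  assumes "group G"
    and "finite S" and "symmetric_generating_set G S"
    and "polynomial_growth G S"
    and "set_pmf \<mu> \<subseteq> carrier G"
    and "adapted G \<mu>" and "smooth G S \<mu>"
    and "f \<in> LHF G S \<mu>"
    and "(\<lambda>x. cmod (f x)) \<in>
           o[(word_length G S) going_to at_top within carrier G](\<lambda>x. real (word_length G S x))"
  shows "f constant_on carrier G"
proof -
  interpret growth_walk G S \<mu>
    using assms by (intro growth_walk.intro growth_walk_axioms.intro) auto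
  have "f x = f \<one>" if "x \<in> carrier G" for x
    using sublinear_LHF_component_constant[OF assms(8,9) bounded_linear_Re abs_Re_le_cmod that]
      sublinear_LHF_component_constant[OF assms(8,9) bounded_linear_Im abs_Im_le_cmod that]
    by (rule complex_eqI)
  then show ?thesis unfolding constant_on_def by blast
qed

end
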